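(* Let $\Gamma$ be an admissible $qW$ graph with $N$ vertices. Then there exist two integers $n\ge 1$ and $0\le r\le n$ with $N=n+r$, and a multiplicatively antisymmetric matrix $\Lambda\in M_n(k^* )$, such that the algebra $\mathcal A(\Gamma)$ associated with $\Gamma$ is isomorphic as a $k$-algebra to the mixed crossed polynomial algebra $S_{n,r}^{\Lambda}(k)$.
   Context: $k$ is a field of characteristic $0$. A matrix $\Lambda=(\lambda_{i,j})\in M_n(k^* )$ is multiplicatively antisymmetric if $\lambda_{i,j}\lambda_{j,i}=\lambda_{i,i}=1$ for all $i,j$. For integers $n\ge1$, $0\le r\le n$ and such a $\Lambda$, $S_{n,r}^{\Lambda}(k)$ is the $k$-algebra generated by $y_1,\dots,y_n,x_1,\dots,x_r$ with relations: $y_iy_j=\lambda_{i,j}y_jy_i$ ($1\le i,j\le n$); $x_iy_i=y_ix_i+1$ ($1\le i\le r$); $x_iy_j=\lambda_{i,j}^{-1}y_jx_i$ ($1\le i\le r$, $1\le j\le n$, $i\ne j$); $x_ix_j=\lambda_{i,j}x_jx_i$ ($1\le i,j\le r$). A $qW$ graph consists of $N$ pairwise distinct vertices $X_1,\dots,X_N$ and weighted oriented edges of two types: Weyl edges from $X_j$ to $X_i$ with weight $p_{j,i}\in\mathbb Z$, and quantum edges from $X_j$ to $X_i$ with weight $\lambda_{j,i}\in k^*$, such that no edge joins a vertex to itself and at most one edge joins any two vertices. A subgraph is obtained by extracting some vertices together with all edges joining them. Two $qW$ graphs are equivalent if one passes from one to the other by finitely many of the following operations or their inverses: putting a Weyl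 edge of weight $0$ between two vertices not joined by an edge; putting a quantum edge of weight $1$ between two vertices not joined by an edge; replacing a Weyl edge of weight $p$ from $X_j$ to $X_i$ by a Weyl edge of weight $-p$ from $X_i$ to $X_j$; replacing a quantum edge of weight $\lambda$ from $X_j$ to $X_i$ by a quantum edge of weight $\lambda^{-1}$ from $X_i$ to $X_j$. A $qW$ graph is admissible if each of its three-vertex subgraphs is equivalent to a graph of one of the following types on vertices $X,Y,Z$: (a) all three pairs joined by quantum edges, of arbitrary weights $\lambda,\mu,\rho\in k^*$; (b) all three pairs joined by Weyl edges, of arbitrary weights $m,n,p\in\mathbb Z$; (c) a Weyl edge of weight $p\in\mathbb Z$ from $X$ to $Y$, a quantum edge of weight $\lambda\in k^*$ from $X$ to $Z$ and a quantum edge of weight $\lambda^{-1}$ from $Y$ to $Z$. The algebra $\mathcal A(\Gamma)$ is the quotient of the free $k$-algebra on $X_1,\dots,X_N$ by the relations: $X_jX_i-X_iX_j=p_{j,i}$ if there is a Weyl edge of weight $p_{j,i}$ from $X_j$ to $X_i$; $X_jX_i=\lambda_{j,i}X_iX_j$ if there is a quantum edge of weight $\lambda_{j,i}$ from $X_j$ to $X_i$; $X_jX_i=X_iX_j$ if $X_j$ and $X_i$ are not joined by an edge. *)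

theory Defs
  imports "HOL-Library.Poly_Mapping" "HOL-Algebra.QuotRing" "HOL-Algebra.Module"
begin

section \<open>Free associative algebras, presentations and isomorphism\<close>

text \<open>
  Finitely supported functions on words, with the convolution product of \<^typ>\<open>'a \<Rightarrow>\<^sub>0 'b\<close>, form
  the free associative algebra. The convolution uses additive notation for the monoid of
  exponents, so the (noncommutative) concatenation of words is written as addition.
\<close>

datatype 'g word = Word (letters: "'g list")

instantiation word :: (type) monoid_add
begin

definition "0 = Word []"

definition "u + v = Word (letters u @ letters v)"

instance
  by standard (simp_all add: zero_word_def plus_word_def)

end

type_synonym ('g, 'k) ncpoly = "'g word \<Rightarrow>\<^sub>0 'k"

definition gen :: "'g \<Rightarrow> ('g, 'k::field) ncpoly" where
  "gen g = Poly_Mapping.single (Word [g]) 1"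

definition scale :: "'k::field \<Rightarrow> ('g, 'k) ncpoly \<Rightarrow> ('g, 'k) ncpoly" where
  "scale c p = Poly_Mapping.map (\<lambda>a. c * a) p"

text \<open>The free algebra on the subset \<open>V\<close> of a type of letters.\<close>

definition free_algebra :: "'g set \<Rightarrow> ('k::field, ('g, 'k) ncpoly) module" where
  "free_algebra V =
    \<lparr>carrier = {p. \<forall>w \<in> Poly_Mapping.keys p. set (letters w) \<subseteq> V},
     mult = (*), one = 1, zero = 0, add = (+), smult = scale\<rparr>"

text \<open>
  The quotient by a two-sided ideal: the ring \<^const>\<open>FactRing\<close> together with the induced scalar
  multiplication of cosets, \<open>c \<cdot> (I + a) = I + c \<cdot> a\<close>.
\<close>

definition quotient_algebra :: "('k, 'a) module \<Rightarrow> 'a set \<Rightarrow> ('k, 'a set) module" where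
  "quotient_algebra A I =
    \<lparr>carrier = carrier (A Quot I), mult = mult (A Quot I), one = one (A Quot I),
     zero = zero (A Quot I), add = add (A Quot I),
     smult = (\<lambda>c C. \<Union>a\<in>C. I +>\<^bsub>A\<^esub> (c \<odot>\<^bsub>A\<^esub> a))\<rparr>"

definition presented_algebra ::
    "'g set \<Rightarrow> ('g, 'k) ncpoly set \<Rightarrow> ('k::field, ('g, 'k) ncpoly set) module" where
  "presented_algebra V R =
    quotient_algebra (free_algebra V) (Idl\<^bsub>free_algebra V\<^esub> R)"

definition algebra_isomorphic :: "('k, 'a) module \<Rightarrow> ('k, 'b) module \<Rightarrow> bool" where
  "algebra_isomorphic A B \<longleftrightarrow>
    (\<exists>h \<in> ring_iso A B. \<forall>c. \<forall>a \<in> carrier A. h (c \<odot>\<^bsub>A\<^esub> a) = c \<odot>\<^bsub>B\<^esub> h a)"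

section \<open>The algebras \<open>S\<^sub>n\<^sub>,\<^sub>r\<^sup>\<Lambda>(k)\<close>\<close>

text \<open>An \<open>n \<times> n\<close> matrix is a function of two indices, of which only the values on \<open>{1..n}\<close> matter.\<close>

definition mult_antisymmetric :: "nat \<Rightarrow> (nat \<Rightarrow> nat \<Rightarrow> 'k::field) \<Rightarrow> bool" where
  "mult_antisymmetric n \<Lambda> \<longleftrightarrow>
    (\<forall>i\<in>{1..n}. \<forall>j\<in>{1..n}. \<Lambda> i j \<noteq> 0 \<and> \<Lambda> i j * \<Lambda> j i = 1 \<and> \<Lambda> i i = 1)"

datatype S_letter = LetterY nat | LetterX nat

abbreviation gen_y :: "nat \<Rightarrow> (S_letter, 'k::field) ncpoly" where
  "gen_y i \<equiv> gen (LetterY i)"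

abbreviation gen_x :: "nat \<Rightarrow> (S_letter, 'k::field) ncpoly" where
  "gen_x i \<equiv> gen (LetterX i)"

definition S_relations ::
    "nat \<Rightarrow> nat \<Rightarrow> (nat \<Rightarrow> nat \<Rightarrow> 'k::field) \<Rightarrow> (S_letter, 'k) ncpoly set" where
  "S_relations n r \<Lambda> =
     {gen_y i * gen_y j - scale (\<Lambda> i j) (gen_y j * gen_y i) | i j.
        i \<in> {1..n} \<and> j \<in> {1..n}} \<union>
     {gen_x i * gen_y i - (gen_y i * gen_x i + 1) | i. i \<in> {1..r}} \<union>
     {gen_x i * gen_y j - scale (inverse (\<Lambda> i j)) (gen_y j * gen_x i) | i j.
        i \<in> {1..r} \<and> j \<in> {1..n} \<and> i \<noteq> j} \<union>
     {gen_x i * gen_x j - scale (\<Lambda> i j) (gen_x j * gen_x i) | i j.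
        i \<in> {1..r} \<and> j \<in> {1..r}}"

definition S_algebra ::
    "nat \<Rightarrow> nat \<Rightarrow> (nat \<Rightarrow> nat \<Rightarrow> 'k::field) \<Rightarrow> ('k, (S_letter, 'k) ncpoly set) module" where
  "S_algebra n r \<Lambda> =
    presented_algebra (LetterY ` {1..n} \<union> LetterX ` {1..r}) (S_relations n r \<Lambda>)"

section \<open>\<open>qW\<close> graphs\<close>

datatype 'k edge_label = Weyl int | Quantum 'k

text \<open>\<open>edges \<Gamma> (u, v) = Some l\<close> means that there is an edge from \<open>u\<close> to \<open>v\<close> of type and weight \<open>l\<close>.\<close>

record ('v, 'k) qW_graph =
  vertices :: "'v set"
  edges :: "'v \<times> 'v \<rightharpoonup> 'k edge_label"

definition is_qW_graph :: "('v, 'k::field) qW_graph \<Rightarrow> bool" where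
  "is_qW_graph \<Gamma> \<longleftrightarrow>
    finite (vertices \<Gamma>) \<and>
    dom (edges \<Gamma>) \<subseteq> vertices \<Gamma> \<times> vertices \<Gamma> \<and>
    (\<forall>u. edges \<Gamma> (u, u) = None) \<and>
    (\<forall>u v. edges \<Gamma> (u, v) = None \<or> edges \<Gamma> (v, u) = None) \<and>
    (\<forall>u v q. edges \<Gamma> (u, v) = Some (Quantum q) \<longrightarrow> q \<noteq> 0)"

definition not_joined :: "('v, 'k) qW_graph \<Rightarrow> 'v \<Rightarrow> 'v \<Rightarrow> bool" where
  "not_joined \<Gamma> u v \<longleftrightarrow> edges \<Gamma> (u, v) = None \<and> edges \<Gamma> (v, u) = None"

definition subgraph :: "('v, 'k) qW_graph \<Rightarrow> 'v set \<Rightarrow> ('v, 'k) qW_graph" where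
  "subgraph \<Gamma> W = \<lparr>vertices = W, edges = edges \<Gamma> |` (W \<times> W)\<rparr>"

text \<open>
  The premise \<^term>\<open>is_qW_graph \<Gamma>\<close> is needed in every rule: the equivalence closure also runs the
  rules backwards, and a reversal step overwrites the edge from \<open>v\<close> to \<open>u\<close>, so without the premise
  one could pass through a structure with two edges between the same vertices.
\<close>

inductive qW_step :: "('v, 'k::field) qW_graph \<Rightarrow> ('v, 'k) qW_graph \<Rightarrow> bool" where
  add_weyl:
    "\<lbrakk>is_qW_graph \<Gamma>; u \<in> vertices \<Gamma>; v \<in> vertices \<Gamma>; u \<noteq> v; not_joined \<Gamma> u v\<rbrakk>
      \<Longrightarrow> qW_step \<Gamma> (\<Gamma>\<lparr>edges := (edges \<Gamma>)((u, v) \<mapsto> Weyl 0)\<rparr>)"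
| add_quantum:
    "\<lbrakk>is_qW_graph \<Gamma>; u \<in> vertices \<Gamma>; v \<in> vertices \<Gamma>; u \<noteq> v; not_joined \<Gamma> u v\<rbrakk>
      \<Longrightarrow> qW_step \<Gamma> (\<Gamma>\<lparr>edges := (edges \<Gamma>)((u, v) \<mapsto> Quantum 1)\<rparr>)"
| reverse_weyl:
    "\<lbrakk>is_qW_graph \<Gamma>; edges \<Gamma> (u, v) = Some (Weyl p)\<rbrakk>
      \<Longrightarrow> qW_step \<Gamma> (\<Gamma>\<lparr>edges := (edges \<Gamma>)((u, v) := None, (v, u) \<mapsto> Weyl (- p))\<rparr>)"
| reverse_quantum:
    "\<lbrakk>is_qW_graph \<Gamma>; edges \<Gamma> (u, v) = Some (Quantum q)\<rbrakk>
      \<Longrightarrow> qW_step \<Gamma> (\<Gamma>\<lparr>edges := (edges \<Gamma>)((u, v) := None, (v, u) \<mapsto> Quantum (inverse q))\<rparr>)"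

definition qW_equivalent :: "('v, 'k::field) qW_graph \<Rightarrow> ('v, 'k) qW_graph \<Rightarrow> bool" where
  "qW_equivalent = equivclp qW_step"

definition joined_quantum :: "('v, 'k) qW_graph \<Rightarrow> 'v \<Rightarrow> 'v \<Rightarrow> bool" where
  "joined_quantum \<Gamma> u v \<longleftrightarrow>
    (\<exists>q. edges \<Gamma> (u, v) = Some (Quantum q) \<or> edges \<Gamma> (v, u) = Some (Quantum q))"

definition joined_weyl :: "('v, 'k) qW_graph \<Rightarrow> 'v \<Rightarrow> 'v \<Rightarrow> bool" where
  "joined_weyl \<Gamma> u v \<longleftrightarrow>
    (\<exists>p. edges \<Gamma> (u, v) = Some (Weyl p) \<or> edges \<Gamma> (v, u) = Some (Weyl p))"

definition type_a :: "('v, 'k::field) qW_graph \<Rightarrow> bool" where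
  "type_a \<Gamma> \<longleftrightarrow> is_qW_graph \<Gamma> \<and>
    (\<exists>X Y Z. distinct [X, Y, Z] \<and> vertices \<Gamma> = {X, Y, Z} \<and>
      joined_quantum \<Gamma> X Y \<and> joined_quantum \<Gamma> Y Z \<and> joined_quantum \<Gamma> X Z)"

definition type_b :: "('v, 'k::field) qW_graph \<Rightarrow> bool" where
  "type_b \<Gamma> \<longleftrightarrow> is_qW_graph \<Gamma> \<and>
    (\<exists>X Y Z. distinct [X, Y, Z] \<and> vertices \<Gamma> = {X, Y, Z} \<and>
      joined_weyl \<Gamma> X Y \<and> joined_weyl \<Gamma> Y Z \<and> joined_weyl \<Gamma> X Z)"

definition type_c :: "('v, 'k::field) qW_graph \<Rightarrow> bool" where
  "type_c \<Gamma> \<longleftrightarrow> is_qW_graph \<Gamma> \<and>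
    (\<exists>X Y Z p q. distinct [X, Y, Z] \<and> vertices \<Gamma> = {X, Y, Z} \<and>
      edges \<Gamma> (X, Y) = Some (Weyl p) \<and>
      edges \<Gamma> (X, Z) = Some (Quantum q) \<and>
      edges \<Gamma> (Y, Z) = Some (Quantum (inverse q)))"

definition qW_admissible :: "('v, 'k::field) qW_graph \<Rightarrow> bool" where
  "qW_admissible \<Gamma> \<longleftrightarrow>
    (\<forall>W \<subseteq> vertices \<Gamma>. card W = 3 \<longrightarrow>
      (\<exists>T. qW_equivalent (subgraph \<Gamma> W) T \<and> (type_a T \<or> type_b T \<or> type_c T)))"

definition qW_relations :: "('v, 'k::field) qW_graph \<Rightarrow> ('v, 'k) ncpoly set" where
  "qW_relations \<Gamma> =
     {gen u * gen v - gen v * gen u - scale (of_int p) 1 | u v p.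
        edges \<Gamma> (u, v) = Some (Weyl p)} \<union>
     {gen u * gen v - scale q (gen v * gen u) | u v q.
        edges \<Gamma> (u, v) = Some (Quantum q)} \<union>
     {gen u * gen v - gen v * gen u | u v.
        u \<in> vertices \<Gamma> \<and> v \<in> vertices \<Gamma> \<and> not_joined \<Gamma> u v}"

definition qW_algebra ::
    "('v, 'k::field) qW_graph \<Rightarrow> ('k, ('v, 'k) ncpoly set) module" where
  "qW_algebra \<Gamma> = presented_algebra (vertices \<Gamma>) (qW_relations \<Gamma>)"

end

theory Submission
  imports Defs
begin

text \<open>
  Only two matrices matter: with \<open>q = 1\<close> for a Weyl pair and \<open>p = 0\<close> for a quantum pair, all relations
  read \<open>u v = q u v \<cdot> v u + p u v\<close>, and \<open>p\<close>, \<open>q\<close> are invariant under equivalence of graphs.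
  Admissibility yields that \<open>p u v \<noteq> 0\<close> forces \<open>q u w \<cdot> q v w = 1\<close> for all \<open>w\<close>. Hence if \<open>w\<close> and \<open>u\<close>
  both pair nontrivially with \<open>v\<close>, their rows of \<open>q\<close> agree, so replacing \<open>w\<close> by a combination of \<open>w\<close>
  and \<open>u\<close> leaves \<open>q\<close> unchanged and transforms \<open>p\<close> as an alternating bilinear form. The symplectic
  Gram--Schmidt process may therefore be run on \<open>p\<close>: the hyperbolic pairs become the \<open>(x\<^sub>i, y\<^sub>i)\<close> with
  \<open>i \<le> r\<close>, a basis of the radical the remaining \<open>y\<^sub>i\<close>, and the rows of \<open>q\<close> at \<open>x\<^sub>i\<close> and \<open>y\<^sub>i\<close> are inverse.
\<close>

section \<open>Scalars and evaluation homomorphisms of free associative algebras\<close>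

section \<open>Substitutions\<close>

text \<open>Turns scalars into constant polynomials supported at the empty word, so that linearity
  facts become ring identities.\<close>

lemma scale_conv_mult: "scale c p = Poly_Mapping.single 0 c * p"
  unfolding scale_def by (rule mult_map_scale_conv_mult)

lemma lookup_scale: "Poly_Mapping.lookup (scale c p) w = c * Poly_Mapping.lookup p w"
  by (simp add: scale_def Poly_Mapping.map.rep_eq when_def)

lemma scale_add_right: "scale c (p + p') = scale c p + scale c p'"
  by (simp add: scale_conv_mult distrib_left)

lemma scale_add_left: "scale (c + d) p = scale c p + scale d p"
  by (simp add: scale_conv_mult distrib_right single_add)

lemma scale_diff_right: "scale c (p - p') = scale c p - scale c p'"
  by (simp add: scale_conv_mult right_diff_distrib)

lemma scale_minus_right: "scale c (- p) = - scale c p"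
  by (simp add: scale_conv_mult)

lemma scale_minus_left: "scale (- c) p = - scale c p"
  by (simp add: scale_conv_mult single_uminus)

lemma scale_scale: "scale c (scale d p) = scale (c * d) p"
  by (simp add: scale_conv_mult mult_single flip: mult.assoc)

lemma scale_mult_left: "scale c p * p' = scale c (p * p')"
  by (simp add: scale_conv_mult mult.assoc)

lemma ncpoly_induct [case_names zero single add]:
  assumes "P 0" "\<And>w c. P (Poly_Mapping.single w c)" "\<And>p p'. P p \<Longrightarrow> P p' \<Longrightarrow> P (p + p')"
  shows "P (p :: ('g, 'k::field) ncpoly)"
proof (induction p rule: update_induct)
  case const
  then show ?case using assms(1) by simp
next
  case (update p a b)
  \<comment> \<open>The key \<open>a\<close> lies outside the support of \<open>p\<close>, so
    overwriting it amounts to adding one term.\<close>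
  have "Poly_Mapping.update a b p = p + Poly_Mapping.single a b"
    using update by (intro poly_mapping_eqI)
      (auto simp: lookup_update lookup_add lookup_single when_def not_in_keys_iff_lookup_eq_zero)
  then show ?case using update assms by simp
qed

text \<open>Constants are central: the empty word is neutral for concatenation on both sides, and
  coefficients commute.\<close>

lemma scale_mult_right: "p * scale c p' = scale c (p * p')"
proof -
  have "p * Poly_Mapping.single 0 c = Poly_Mapping.single 0 c * p"
    by (induction p rule: ncpoly_induct)
      (simp_all add: distrib_left distrib_right mult_single mult.commute)
  then show ?thesis by (simp add: scale_conv_mult flip: mult.assoc)
qed

lemma scale_zero_left [simp]: "scale 0 p = 0"
  by (simp add: scale_conv_mult)

lemma scale_zero_right [simp]: "scale c 0 = 0"
  by (simp add: scale_conv_mult)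

lemma scale_one [simp]: "scale 1 p = p"
  by (simp add: scale_conv_mult)

lemmas scale_simps = scale_add_right scale_diff_right scale_minus_right scale_minus_left
  scale_scale scale_mult_left scale_mult_right

text \<open>The algebra homomorphism out of the free algebra that extends \<open>f\<close>, as in
  its universal property.\<close>

definition substitute :: "('g \<Rightarrow> ('h, 'k) ncpoly) \<Rightarrow> ('g, 'k::field) ncpoly \<Rightarrow> ('h, 'k) ncpoly" where
  "substitute f p =
    (\<Sum>w\<in>Poly_Mapping.keys p. scale (Poly_Mapping.lookup p w) (prod_list (map f (letters w))))"

text \<open>Lets two polynomials be summed over one common set of words, as additivity requires; the
  extra coefficients vanish.\<close>

lemma substitute_superset:
  assumes "finite W" "Poly_Mapping.keys p \<subseteq> W"
  shows "substitute f p =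
    (\<Sum>w\<in>W. scale (Poly_Mapping.lookup p w) (prod_list (map f (letters w))))"
  unfolding substitute_def
  using assms by (intro sum.mono_neutral_left) (auto simp: in_keys_iff)

lemma substitute_add: "substitute f (p + p') = substitute f p + substitute f p'"
proof -
  let ?W = "Poly_Mapping.keys p \<union> Poly_Mapping.keys p'"
  have "substitute f (p + p') =
      (\<Sum>w\<in>?W. scale (Poly_Mapping.lookup (p + p') w) (prod_list (map f (letters w))))"
    by (intro substitute_superset keys_add) simp
  also have "\<dots> = substitute f p + substitute f p'"
    by (simp add: substitute_superset[of ?W p] substitute_superset[of ?W p'] lookup_add
        scale_add_left sum.distrib)
  finally show ?thesis .
qed

lemma substitute_zero [simp]: "substitute f 0 = 0"
  by (simp add: substitute_def)

lemma substitute_minus: "substitute f (- p) = - substitute f p"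
  using substitute_add[of f p "- p"] by (simp add: eq_neg_iff_add_eq_0 add.commute)

lemma substitute_diff: "substitute f (p - p') = substitute f p - substitute f p'"
  using substitute_add[of f p "- p'"] by (simp add: substitute_minus)

lemma substitute_single:
  "substitute f (Poly_Mapping.single w c) = scale c (prod_list (map f (letters w)))"
  by (simp add: substitute_def)

text \<open>Both sides are additive in each argument, so single terms suffice, and there
  concatenation of words becomes the product of their images.\<close>

lemma substitute_mult: "substitute f (p * p') = substitute f p * substitute f p'"
proof (induction p rule: ncpoly_induct)
  case (single w c)
  show ?case
  proof (induction p' rule: ncpoly_induct)
    case (single w' c')
    show ?case
      by (simp add: mult_single substitute_single plus_word_def scale_simps mult.commute)
  qed (simp_all add: distrib_left substitute_add)
qed (simp_all add: distrib_right substitute_add)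

lemma substitute_one [simp]: "substitute f 1 = 1"
  by (simp add: substitute_single zero_word_def flip: single_one)

lemma substitute_scale: "substitute f (scale c p) = scale c (substitute f p)"
  by (simp add: scale_conv_mult[of c p] substitute_mult substitute_single scale_simps zero_word_def)

lemma substitute_gen [simp]: "substitute f (gen g) = f g"
  by (simp add: gen_def substitute_single)

section \<open>Ideals and quotients of free algebras; a criterion for isomorphism\<close>

section \<open>Presented algebras\<close>

lemma carrier_free_algebra:
  "p \<in> carrier (free_algebra V) \<longleftrightarrow> (\<forall>w \<in> Poly_Mapping.keys p. set (letters w) \<subseteq> V)"
  by (simp add: free_algebra_def)

lemma free_algebra_simps [simp]:
  "mult (free_algebra V) = (*)" "one (free_algebra V) = 1" "zero (free_algebra V) = 0"
  "add (free_algebra V) = (+)" "module.smult (free_algebra V) = scale"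
  by (simp_all add: free_algebra_def)

lemma free_algebra_closed:
  "0 \<in> carrier (free_algebra V)" "1 \<in> carrier (free_algebra V)"
  "v \<in> V \<Longrightarrow> gen v \<in> carrier (free_algebra V)"
  "p \<in> carrier (free_algebra V) \<Longrightarrow> p' \<in> carrier (free_algebra V) \<Longrightarrow> p + p' \<in> carrier (free_algebra V)"
  "p \<in> carrier (free_algebra V) \<Longrightarrow> p' \<in> carrier (free_algebra V) \<Longrightarrow> p * p' \<in> carrier (free_algebra V)"
  "p \<in> carrier (free_algebra V) \<Longrightarrow> scale c p \<in> carrier (free_algebra V)"
  "p \<in> carrier (free_algebra V) \<Longrightarrow> - p \<in> carrier (free_algebra V)"
  "p \<in> carrier (free_algebra V) \<Longrightarrow> p' \<in> carrier (free_algebra V) \<Longrightarrow> p - p' \<in> carrier (free_algebra V)"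
proof -
  show 1: "p + p' \<in> carrier (free_algebra V)"
    if "p \<in> carrier (free_algebra V)" "p' \<in> carrier (free_algebra V)" for p p'
    using that keys_add[of p p'] by (auto simp: carrier_free_algebra)
  show 2: "p * p' \<in> carrier (free_algebra V)"
    if "p \<in> carrier (free_algebra V)" "p' \<in> carrier (free_algebra V)" for p p'
    using that keys_mult[of p p'] by (fastforce simp: carrier_free_algebra plus_word_def)
  show 3: "scale c p \<in> carrier (free_algebra V)" if "p \<in> carrier (free_algebra V)" for p
    using that by (auto simp: carrier_free_algebra in_keys_iff lookup_scale)
  show 4: "- p \<in> carrier (free_algebra V)" if "p \<in> carrier (free_algebra V)" for p
    using that by (auto simp: carrier_free_algebra)
  show "p - p' \<in> carrier (free_algebra V)"
    if "p \<in> carrier (free_algebra V)" "p' \<in> carrier (free_algebra V)" for p p'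
    using 1[OF that(1) 4[OF that(2)]] by simp
qed (auto simp: carrier_free_algebra gen_def keys_one zero_word_def)

lemma free_algebra_ring: "ring (free_algebra V :: ('k::field, ('g, 'k) ncpoly) module)"
proof (rule ringI)
  show "abelian_group (free_algebra V :: ('k, ('g, 'k) ncpoly) module)"
    by (rule abelian_groupI)
      (auto simp: free_algebra_closed add_ac intro: bexI[of _ "- _"])
  show "monoid (free_algebra V :: ('k, ('g, 'k) ncpoly) module)"
    by (rule monoidI) (auto simp: free_algebra_closed mult.assoc)
qed (auto simp: distrib_left distrib_right)

lemma substitute_closed:
  assumes "p \<in> carrier (free_algebra V)" "\<And>v. v \<in> V \<Longrightarrow> f v \<in> carrier (free_algebra V')"
  shows "substitute f p \<in> carrier (free_algebra V')"
proof -
  interpret ring "free_algebra V' :: ('b, ('c, 'b) ncpoly) module"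
    by (rule free_algebra_ring)
  have list: "prod_list (map f xs) \<in> carrier (free_algebra V')" if "set xs \<subseteq> V" for xs
    using that by (induction xs) (auto simp: free_algebra_closed assms)
  have "(\<Sum>w\<in>W. scale (Poly_Mapping.lookup p w) (prod_list (map f (letters w))))
      \<in> carrier (free_algebra V')" if "W \<subseteq> Poly_Mapping.keys p" for W
    using finite_subset[OF that finite_keys] that
  proof (induction W rule: finite_induct)
    case (insert w W)
    then show ?case
      using assms(1) by (auto simp: carrier_free_algebra[of p] intro!: free_algebra_closed list)
  qed (simp add: free_algebra_closed)
  then show ?thesis by (simp add: substitute_def)
qed

text \<open>The composite is a homomorphism fixing the letters in \<open>V\<close>, so it fixes
  every word over \<open>V\<close> and all linear combinations of them.\<close>

lemma substitute_substitute:
  assumes "p \<in> carrier (free_algebra V)" "\<And>v. v \<in> V \<Longrightarrow> substitute g (f v) = gen v"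
  shows "substitute g (substitute f p) = p"
proof -
  have sum: "substitute g (sum h W) = (\<Sum>w\<in>W. substitute g (h w))" for h and W :: "'d set"
    by (induction W rule: infinite_finite_induct) (auto simp: substitute_add)
  have list: "substitute g (prod_list (map f xs)) = Poly_Mapping.single (Word xs) 1"
    if "set xs \<subseteq> V" for xs
    using that
    by (induction xs)
      (auto simp: substitute_mult assms(2) gen_def mult_single plus_word_def simp flip: zero_word_def)
  have "substitute g (substitute f p) =
      (\<Sum>w\<in>Poly_Mapping.keys p. Poly_Mapping.single w (Poly_Mapping.lookup p w))"
    unfolding substitute_def[of f] sum substitute_scale
    using assms(1)
    by (intro sum.cong) (auto simp: list carrier_free_algebra scale_conv_mult mult_single)
  also have "\<dots> = p"
    by (rule poly_mapping_eqI)
      (auto simp: lookup_sum lookup_single when_def in_keys_iff)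
  finally show ?thesis .
qed

lemma genideal_free_algebra:
  assumes "R \<subseteq> carrier (free_algebra V)"
  shows "ideal (Idl\<^bsub>free_algebra V\<^esub> R) (free_algebra V)"
  by (rule ring.genideal_ideal[OF free_algebra_ring assms])

lemma ideal_free_algebraD:
  assumes "ideal I (free_algebra V)"
  shows "0 \<in> I"
    and "p \<in> I \<Longrightarrow> p' \<in> I \<Longrightarrow> p + p' \<in> I"
    and "p \<in> I \<Longrightarrow> a \<in> carrier (free_algebra V) \<Longrightarrow> a * p \<in> I"
    and "p \<in> I \<Longrightarrow> scale c p \<in> I"
    and "p \<in> I \<Longrightarrow> - p \<in> I"
    and "p \<in> I \<Longrightarrow> p \<in> carrier (free_algebra V)"
proof -
  interpret ideal I "free_algebra V" by fact
  show "0 \<in> I" using additive_subgroup.zero_closed[OF is_additive_subgroup] by simp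
  show "p \<in> I \<Longrightarrow> p' \<in> I \<Longrightarrow> p + p' \<in> I"
    using additive_subgroup.a_closed[OF is_additive_subgroup] by simp
  show mult: "p \<in> I \<Longrightarrow> a \<in> carrier (free_algebra V) \<Longrightarrow> a * p \<in> I" for p a
    using I_l_closed by simp
  show sc: "p \<in> I \<Longrightarrow> scale c p \<in> I" for c p
    unfolding scale_conv_mult by (rule mult) (auto simp: carrier_free_algebra zero_word_def)
  show "p \<in> I \<Longrightarrow> - p \<in> I" using sc[of p "- 1"] by (simp add: scale_minus_left)
  show "p \<in> I \<Longrightarrow> p \<in> carrier (free_algebra V)" using Icarr by simp
qed

lemma substitute_ring_hom:
  assumes "\<And>v. v \<in> V \<Longrightarrow> f v \<in> carrier (free_algebra V')"
  shows "ring_hom_ring (free_algebra V) (free_algebra V') (substitute f)"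
  by (rule ring_hom_ringI)
    (auto simp: free_algebra_ring substitute_closed assms substitute_mult substitute_add)

text \<open>The preimage of an ideal under a homomorphism is an ideal; once it contains
  \<open>R\<close>, it contains all that \<open>R\<close> generates. Thus only relators have to be
  checked.\<close>

lemma substitute_genideal:
  assumes "R \<subseteq> carrier (free_algebra V)" "R' \<subseteq> carrier (free_algebra V')"
    and "\<And>v. v \<in> V \<Longrightarrow> f v \<in> carrier (free_algebra V')"
    and "\<And>p. p \<in> R \<Longrightarrow> substitute f p \<in> Idl\<^bsub>free_algebra V'\<^esub> R'"
    and "p \<in> Idl\<^bsub>free_algebra V\<^esub> R"
  shows "substitute f p \<in> Idl\<^bsub>free_algebra V'\<^esub> R'"
proof -
  let ?I = "{p \<in> carrier (free_algebra V). substitute f p \<in> Idl\<^bsub>free_algebra V'\<^esub> R'}"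
  have "ideal ?I (free_algebra V)"
    by (rule ring_hom_ring.ideal_vimage[OF substitute_ring_hom genideal_free_algebra])
      (use assms in auto)
  then have "Idl\<^bsub>free_algebra V\<^esub> R \<subseteq> ?I"
    by (rule ring.genideal_minimal[OF free_algebra_ring]) (use assms in auto)
  then show ?thesis using assms(5) by auto
qed

text \<open>The union defining scalar multiplication collapses: representatives of one coset differ
  by an element of \<open>I\<close>, and \<open>I\<close> is closed under
  \<open>scale c\<close>.\<close>

lemma quotient_algebra_smult:
  assumes "ideal I (free_algebra V)" "a \<in> carrier (free_algebra V)"
  shows "module.smult (quotient_algebra (free_algebra V) I) c (I +>\<^bsub>free_algebra V\<^esub> a) =
    I +>\<^bsub>free_algebra V\<^esub> scale c a"
proof -
  interpret ideal I "free_algebra V" by fact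
  have "I +>\<^bsub>free_algebra V\<^esub> scale c b = I +>\<^bsub>free_algebra V\<^esub> scale c a"
    if b: "b \<in> I +>\<^bsub>free_algebra V\<^esub> a" for b
  proof -
    obtain i where i: "i \<in> I" "b = i + a"
      using b by (auto simp: a_r_coset_def')
    have "scale c b \<in> I +>\<^bsub>free_algebra V\<^esub> scale c a"
      using ideal_free_algebraD(4)[OF assms(1) i(1)]
      by (auto simp: a_r_coset_def' i(2) scale_add_right)
    then show ?thesis
      using additive_subgroup.a_subgroup[OF is_additive_subgroup] assms(2)
      by (metis a_repr_independence free_algebra_closed(6))
  qed
  moreover have "a \<in> I +>\<^bsub>free_algebra V\<^esub> a"
    using a_rcos_self[OF assms(2)] by simp
  ultimately have "(\<Union>b\<in>I +>\<^bsub>free_algebra V\<^esub> a. I +>\<^bsub>free_algebra V\<^esub> scale c b) =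
      I +>\<^bsub>free_algebra V\<^esub> scale c a"
    by blast
  then show ?thesis
    by (simp add: quotient_algebra_def)
qed

lemma ring_iso_quotient_algebra:
  "ring_iso (A Quot I) (B Quot J) = ring_iso (quotient_algebra A I) (quotient_algebra B J)"
  by (simp add: ring_iso_def ring_hom_def quotient_algebra_def)

text \<open>First isomorphism theorem for the substitution \<open>f\<close> followed by the
  projection modulo \<open>R'\<close>. The substitution \<open>g\<close> in the opposite direction
  yields surjectivity and shows that the kernel is no larger than the ideal of
  \<open>R\<close>.\<close>

lemma algebra_isomorphic_presented:
  fixes R :: "('g, 'k::field) ncpoly set" and R' :: "('h, 'k) ncpoly set"
  assumes R: "R \<subseteq> carrier (free_algebra V)" "R' \<subseteq> carrier (free_algebra V')"
    and f: "\<And>v. v \<in> V \<Longrightarrow> f v \<in> carrier (free_algebra V')"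
    and g: "\<And>v. v \<in> V' \<Longrightarrow> g v \<in> carrier (free_algebra V)"
    and fR: "\<And>p. p \<in> R \<Longrightarrow> substitute f p \<in> Idl\<^bsub>free_algebra V'\<^esub> R'"
    and gR: "\<And>p. p \<in> R' \<Longrightarrow> substitute g p \<in> Idl\<^bsub>free_algebra V\<^esub> R"
    and gf: "\<And>v. v \<in> V \<Longrightarrow> substitute g (f v) = gen v"
    and fg: "\<And>v. v \<in> V' \<Longrightarrow> substitute f (g v) = gen v"
  shows "algebra_isomorphic (presented_algebra V R) (presented_algebra V' R')"
proof -
  define A where "A = (free_algebra V :: ('k, ('g, 'k) ncpoly) module)"
  define B where "B = (free_algebra V' :: ('k, ('h, 'k) ncpoly) module)"
  define I where "I = Idl\<^bsub>A\<^esub> R"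
  define J where "J = Idl\<^bsub>B\<^esub> R'"
  have I: "ideal I A" and J: "ideal J B"
    unfolding I_def A_def J_def B_def by (intro genideal_free_algebra R)+
  interpret I: ideal I A by fact
  interpret J: ideal J B by fact
  interpret f: ring_hom_ring A B "substitute f"
    unfolding A_def B_def by (rule substitute_ring_hom) (rule f)
  define h where "h = (\<lambda>p. J +>\<^bsub>B\<^esub> substitute f p)"
  interpret h: ring_hom_ring A "B Quot J" h
    using ring_hom_trans[OF f.homh J.rcos_ring_hom]
    by (intro ring_hom_ringI2 I.ring_axioms J.quotient_is_ring) (simp_all add: h_def o_def)
  have kernel: "a_kernel A (B Quot J) h = I"
  proof -
    have "h p = J \<longleftrightarrow> p \<in> I" if "p \<in> carrier A" for p
    proof -
      have "h p = J \<longleftrightarrow> substitute f p \<in> J"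
        using f.hom_closed[OF that] J.a_rcos_self J.a_rcos_const unfolding h_def by metis
      \<comment> \<open>Forwards, \<open>g\<close> carries \<open>substitute f p\<close> back to
        \<open>p\<close> and \<open>J\<close> into \<open>I\<close>; backwards, \<open>f\<close>
        carries \<open>I\<close> into \<open>J\<close>.\<close>
      also have "\<dots> \<longleftrightarrow> p \<in> I"
        using substitute_genideal[OF R(2,1) g gR, of "substitute f p"]
          substitute_genideal[OF R f fR, of p] that
          substitute_substitute[OF _ gf, of p V, simplified]
        unfolding I_def J_def A_def B_def by metis
      finally show ?thesis .
    qed
    moreover have "\<zero>\<^bsub>B Quot J\<^esub> = J"
      by (simp add: FactRing_def)
    ultimately show ?thesis
      using I.Icarr unfolding a_kernel_def' by blast
  qed
  have surj: "h ` carrier A = carrier (B Quot J)"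
  proof
    show "carrier (B Quot J) \<subseteq> h ` carrier A"
    proof
      fix C assume "C \<in> carrier (B Quot J)"
      then obtain b where b: "b \<in> carrier B" "C = J +>\<^bsub>B\<^esub> b"
        by (auto simp: FactRing_def A_RCOSETS_def')
      have "C = h (substitute g b)"
        using substitute_substitute[of b V' f g] fg b by (simp add: h_def B_def)
      moreover have "substitute g b \<in> carrier A"
        using substitute_closed[of b V' g V] g b unfolding A_def B_def by auto
      ultimately show "C \<in> h ` carrier A" by auto
    qed
  qed auto
  have iso: "(\<lambda>X. the_elem (h ` X)) \<in> ring_iso (A Quot I) (B Quot J)"
    using h.FactRing_iso_set[OF surj] by (simp add: kernel)
  have elem: "the_elem (h ` (I +>\<^bsub>A\<^esub> a)) = h a" if "a \<in> carrier A" for a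
    using h.the_elem_simp[OF that] by (simp add: kernel)
  show ?thesis
    unfolding algebra_isomorphic_def presented_algebra_def
  proof (intro bexI ballI allI)
    show "(\<lambda>X. the_elem (h ` X)) \<in> ring_iso
      (quotient_algebra (free_algebra V) (Idl\<^bsub>free_algebra V\<^esub> R))
      (quotient_algebra (free_algebra V') (Idl\<^bsub>free_algebra V'\<^esub> R'))"
      using iso by (simp add: ring_iso_quotient_algebra A_def B_def I_def J_def)
  next
    fix c C
    assume "C \<in> carrier (quotient_algebra (free_algebra V) (Idl\<^bsub>free_algebra V\<^esub> R))"
    then obtain a where a: "a \<in> carrier A" "C = I +>\<^bsub>A\<^esub> a"
      by (auto simp: quotient_algebra_def FactRing_def A_RCOSETS_def' A_def I_def)
    have sa: "scale c a \<in> carrier A"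
      using a by (simp add: A_def free_algebra_closed)
    have "module.smult (quotient_algebra A I) c C = I +>\<^bsub>A\<^esub> scale c a"
      using quotient_algebra_smult I a by (simp add: A_def)
    moreover have "module.smult (quotient_algebra B J) c (h a) = h (scale c a)"
      using quotient_algebra_smult[of J V'] J f.hom_closed[OF a(1)]
      by (simp add: B_def h_def substitute_scale)
    ultimately show "the_elem (h ` module.smult (quotient_algebra (free_algebra V)
          (Idl\<^bsub>free_algebra V\<^esub> R)) c C) =
        module.smult (quotient_algebra (free_algebra V') (Idl\<^bsub>free_algebra V'\<^esub> R')) c
          (the_elem (h ` C))"
      using elem[OF a(1)] elem[OF sa] by (simp add: a(2) flip: A_def B_def I_def J_def)
  qed
qed

lemma algebra_isomorphic_trans:
  assumes "algebra_isomorphic A B" "algebra_isomorphic B C"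
  shows "algebra_isomorphic A C"
proof -
  obtain h h' where h: "h \<in> ring_iso A B" "\<forall>c. \<forall>a\<in>carrier A. h (c \<odot>\<^bsub>A\<^esub> a) = c \<odot>\<^bsub>B\<^esub> h a"
    and h': "h' \<in> ring_iso B C" "\<forall>c. \<forall>a\<in>carrier B. h' (c \<odot>\<^bsub>B\<^esub> a) = c \<odot>\<^bsub>C\<^esub> h' a"
    using assms by (auto simp: algebra_isomorphic_def)
  show ?thesis
    unfolding algebra_isomorphic_def
    using ring_iso_set_trans[OF h(1) h'(1)] h(2) h'(2) ring_iso_memE(1)[OF h(1)]
    by (intro bexI[of _ "h' \<circ> h"]) auto
qed

section \<open>Presentations with one skew and one multiplicatively skew matrix\<close>

section \<open>Algebras given by weight matrices\<close>

definition relator :: "'g \<Rightarrow> 'g \<Rightarrow> 'k \<Rightarrow> 'k \<Rightarrow> ('g, 'k::field) ncpoly" where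
  "relator u v a b = gen u * gen v - scale a (gen v * gen u) - scale b 1"

definition weight_relators ::
    "'v set \<Rightarrow> ('v \<Rightarrow> 'v \<Rightarrow> 'k::field) \<Rightarrow> ('v \<Rightarrow> 'v \<Rightarrow> 'k) \<Rightarrow> ('v, 'k) ncpoly set" where
  "weight_relators V p q = {relator u v (q u v) (p u v) | u v. u \<in> V \<and> v \<in> V}"

definition weight_algebra ::
    "'v set \<Rightarrow> ('v \<Rightarrow> 'v \<Rightarrow> 'k::field) \<Rightarrow> ('v \<Rightarrow> 'v \<Rightarrow> 'k) \<Rightarrow> ('k, ('v, 'k) ncpoly set) module" where
  "weight_algebra V p q = presented_algebra V (weight_relators V p q)"

lemma relator_closed: "u \<in> V \<Longrightarrow> v \<in> V \<Longrightarrow> relator u v a b \<in> carrier (free_algebra V)"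
  by (simp add: relator_def free_algebra_closed)

lemma weight_relators_closed: "weight_relators V p q \<subseteq> carrier (free_algebra V)"
  by (auto simp: weight_relators_def relator_closed)

lemma relator_in_genideal:
  "u \<in> V \<Longrightarrow> v \<in> V \<Longrightarrow>
    relator u v (q u v) (p u v) \<in> Idl\<^bsub>free_algebra V\<^esub> (weight_relators V p q)"
  using ring.genideal_self[OF free_algebra_ring weight_relators_closed, of V p q]
  by (auto simp: weight_relators_def)

text \<open>Solves the relation for the product in the other order, using the inverse
  \<open>c\<close> of \<open>a\<close>.\<close>

lemma relator_swap:
  assumes "c * a = 1"
  shows "relator u v a b = - scale a (relator v u c (- (c * b)))"
proof -
  have *: "a * c = 1" "a * (c * b) = b"
    using assms by (metis mult.assoc mult.commute mult_1)+
  show ?thesis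
    by (simp add: relator_def scale_simps *)
qed

text \<open>
  The condition \<open>p_imp_q_mult\<close> is what admissibility of triangles amounts to.
\<close>

locale qW_weights =
  fixes V :: "'v set" and p q :: "'v \<Rightarrow> 'v \<Rightarrow> 'k::field"
  assumes p_skew: "u \<in> V \<Longrightarrow> v \<in> V \<Longrightarrow> p u v = - p v u"
    and p_diag: "u \<in> V \<Longrightarrow> p u u = 0"
    and q_mult_swap: "u \<in> V \<Longrightarrow> v \<in> V \<Longrightarrow> q u v * q v u = 1"
    and q_diag: "u \<in> V \<Longrightarrow> q u u = 1"
    and p_imp_q: "u \<in> V \<Longrightarrow> v \<in> V \<Longrightarrow> p u v \<noteq> 0 \<Longrightarrow> q u v = 1"
    and p_imp_q_mult: "u \<in> V \<Longrightarrow> v \<in> V \<Longrightarrow> w \<in> V \<Longrightarrow> p u v \<noteq> 0 \<Longrightarrow> q u w * q v w = 1"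
begin

lemma q_nonzero: "u \<in> V \<Longrightarrow> v \<in> V \<Longrightarrow> q u v \<noteq> 0"
  using q_mult_swap[of u v] by auto

lemma q_eq_inverse: "u \<in> V \<Longrightarrow> v \<in> V \<Longrightarrow> q u v = inverse (q v u)"
  using q_mult_swap[of u v] q_nonzero[of v u] by (simp add: field_simps)

text \<open>Both rows are inverse to the row of \<open>v\<close>. This provides the hypothesis on
  rows under which a shear is compatible with \<open>q\<close>.\<close>

lemma p_imp_q_row_eq:
  assumes "u \<in> V" "v \<in> V" "w \<in> V" "z \<in> V" "p u v \<noteq> 0" "p w v \<noteq> 0"
  shows "q w z = q u z"
  using p_imp_q_mult[of u v z] p_imp_q_mult[of w v z] q_nonzero[of v z] assms
  by (metis mult_right_cancel)

text \<open>Diagonal relators vanish and the two relators of a pair are multiples of each other, so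
  one order per pair is enough. The graph presentation and that of \<open>S_algebra\<close> both
  leave out one order for some pairs.\<close>

lemma genideal_eq_weight_relators:
  assumes "R \<subseteq> weight_relators V p q"
    and "\<And>u v. u \<in> V \<Longrightarrow> v \<in> V \<Longrightarrow> u \<noteq> v \<Longrightarrow>
      relator u v (q u v) (p u v) \<in> R \<or> relator v u (q v u) (p v u) \<in> R"
  shows "Idl\<^bsub>free_algebra V\<^esub> R = Idl\<^bsub>free_algebra V\<^esub> (weight_relators V p q)"
proof
  have R: "R \<subseteq> carrier (free_algebra V)"
    using assms(1) weight_relators_closed by blast
  note I = genideal_free_algebra[OF R]
  have self: "R \<subseteq> Idl\<^bsub>free_algebra V\<^esub> R"
    by (rule ring.genideal_self[OF free_algebra_ring R])
  show "Idl\<^bsub>free_algebra V\<^esub> R \<subseteq> Idl\<^bsub>free_algebra V\<^esub> (weight_relators V p q)"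
    by (rule ring.subset_Idl_subset[OF free_algebra_ring weight_relators_closed assms(1)])
  have "relator u v (q u v) (p u v) \<in> Idl\<^bsub>free_algebra V\<^esub> R" if uv: "u \<in> V" "v \<in> V" for u v
  proof -
    consider "u = v" | "relator u v (q u v) (p u v) \<in> R" | "relator v u (q v u) (p v u) \<in> R"
      using assms(2) uv by blast
    then show ?thesis
    proof cases
      case 1
      then show ?thesis
        using ideal_free_algebraD(1)[OF I] uv by (simp add: relator_def q_diag p_diag)
    next
      case 2
      then show ?thesis using self by blast
    next
      case 3
      \<comment> \<open>Brings skew-symmetry into the shape of \<open>relator_swap\<close>: where
        \<open>p v u\<close> is nonzero, \<open>q v u\<close> is 1.\<close>
      have "p v u = - (q v u * p u v)"
        using p_skew[OF uv] p_imp_q[of v u] uv by (cases "p v u = 0") auto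
      then have "relator u v (q u v) (p u v) = - scale (q u v) (relator v u (q v u) (p v u))"
        using relator_swap[of "q v u" "q u v" u v "p u v"] q_mult_swap[of v u] uv by simp
      then show ?thesis
        using 3 self ideal_free_algebraD(4,5)[OF I] by auto
    qed
  qed
  then show "Idl\<^bsub>free_algebra V\<^esub> (weight_relators V p q) \<subseteq> Idl\<^bsub>free_algebra V\<^esub> R"
    by (intro ring.genideal_minimal[OF free_algebra_ring I]) (auto simp: weight_relators_def)
qed

lemma presented_algebra_eq_weight_algebra:
  assumes "R \<subseteq> weight_relators V p q"
    and "\<And>u v. u \<in> V \<Longrightarrow> v \<in> V \<Longrightarrow> u \<noteq> v \<Longrightarrow>
      relator u v (q u v) (p u v) \<in> R \<or> relator v u (q v u) (p v u) \<in> R"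
  shows "presented_algebra V R = weight_algebra V p q"
  using genideal_eq_weight_relators[OF assms]
  by (simp add: presented_algebra_def weight_algebra_def)

end

lemma qW_weights_reindex:
  assumes "qW_weights V p q" "\<And>l. l \<in> L \<Longrightarrow> \<psi> l \<in> V"
  shows "qW_weights L (\<lambda>l m. p (\<psi> l) (\<psi> m)) (\<lambda>l m. q (\<psi> l) (\<psi> m))"
proof -
  interpret qW_weights V p q by fact
  show ?thesis
    by unfold_locales
      (use assms(2) in \<open>blast intro: p_skew p_diag q_mult_swap q_diag p_imp_q p_imp_q_mult\<close>)+
qed

text \<open>Serves to pass from vertices to the letters of \<open>S_algebra\<close>; the inverse
  bijection gives the inverse substitution.\<close>

lemma weight_algebra_reindex:
  assumes "bij_betw \<psi> L V"
  shows "algebra_isomorphic (weight_algebra V p q)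
    (weight_algebra L (\<lambda>l m. p (\<psi> l) (\<psi> m)) (\<lambda>l m. q (\<psi> l) (\<psi> m)))"
proof -
  define \<phi> where "\<phi> = inv_into L \<psi>"
  have \<phi>: "\<phi> v \<in> L" "\<psi> (\<phi> v) = v" if "v \<in> V" for v
    using assms that unfolding \<phi>_def
    by (auto simp: bij_betw_def inv_into_into f_inv_into_f)
  have \<psi>: "\<psi> l \<in> V" "\<phi> (\<psi> l) = l" if "l \<in> L" for l
    using assms that unfolding \<phi>_def by (auto simp: bij_betw_def)
  have relator: "substitute (\<lambda>v. gen (\<chi> v)) (relator u v a b) = relator (\<chi> u) (\<chi> v) a b"
    for \<chi> :: "'x \<Rightarrow> 'y" and u v and a b :: 'c
    by (simp add: relator_def substitute_diff substitute_mult substitute_scale)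
  show ?thesis
    unfolding weight_algebra_def
  proof (rule algebra_isomorphic_presented[where f = "\<lambda>v. gen (\<phi> v)" and g = "\<lambda>l. gen (\<psi> l)"])
    show "substitute (\<lambda>v. gen (\<phi> v)) r \<in> Idl\<^bsub>free_algebra L\<^esub>
        (weight_relators L (\<lambda>l m. p (\<psi> l) (\<psi> m)) (\<lambda>l m. q (\<psi> l) (\<psi> m)))"
      if r: "r \<in> weight_relators V p q" for r
    proof -
      obtain u v where "u \<in> V" "v \<in> V" "r = relator u v (q u v) (p u v)"
        using r by (auto simp: weight_relators_def)
      then show ?thesis
        using relator_in_genideal[of "\<phi> u" L "\<phi> v" "\<lambda>l m. q (\<psi> l) (\<psi> m)" "\<lambda>l m. p (\<psi> l) (\<psi> m)"]
        by (simp add: relator \<phi>)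
    qed
    show "substitute (\<lambda>l. gen (\<psi> l)) r \<in> Idl\<^bsub>free_algebra V\<^esub> (weight_relators V p q)"
      if "r \<in> weight_relators L (\<lambda>l m. p (\<psi> l) (\<psi> m)) (\<lambda>l m. q (\<psi> l) (\<psi> m))" for r
      using that by (auto simp: weight_relators_def[of L] relator \<psi> intro!: relator_in_genideal)
  qed (simp_all add: weight_relators_closed free_algebra_closed \<phi> \<psi>)
qed

section \<open>Changes of generators and the symplectic pivot step\<close>

section \<open>Elimination\<close>

text \<open>One round of elimination with pivot \<open>u\<close>, changing all generators
  simultaneously.\<close>

definition shear :: "('v \<Rightarrow> 'k) \<Rightarrow> ('v \<Rightarrow> 'k) \<Rightarrow> 'v \<Rightarrow> 'v \<Rightarrow> ('v, 'k::field) ncpoly" where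
  "shear \<gamma> \<alpha> u w = scale (\<gamma> w) (gen w) + scale (\<alpha> w) (gen u)"

text \<open>
  The coefficient of the \<open>\<alpha> w * \<alpha> s\<close> term is \<open>p u u = 0\<close>, so this is the bilinear extension of \<open>p\<close>
  evaluated at \<open>\<gamma> w \<cdot> w + \<alpha> w \<cdot> u\<close> and \<open>\<gamma> s \<cdot> s + \<alpha> s \<cdot> u\<close>.
\<close>

definition sheared ::
    "('v \<Rightarrow> 'k) \<Rightarrow> ('v \<Rightarrow> 'k) \<Rightarrow> 'v \<Rightarrow> ('v \<Rightarrow> 'v \<Rightarrow> 'k::field) \<Rightarrow> 'v \<Rightarrow> 'v \<Rightarrow> 'k" where
  "sheared \<gamma> \<alpha> u p w s = \<gamma> w * \<gamma> s * p w s + \<gamma> w * \<alpha> s * p w u + \<alpha> w * \<gamma> s * p u s"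

context qW_weights
begin

lemma q_column_eq:
  assumes "\<And>z. z \<in> V \<Longrightarrow> q s z = q u z" "s \<in> V" "u \<in> V" "w \<in> V"
  shows "q w s = q w u"
  using q_eq_inverse[of w s] q_eq_inverse[of w u] assms by simp

text \<open>Expanding the product of the two images gives four terms. Where \<open>\<alpha>\<close>
  is nonzero the row of \<open>q\<close> is that of \<open>u\<close>, so three terms complete to
  relators, each with the right value of \<open>q\<close>; in the fourth,
  \<open>gen u * gen u\<close> cancels because \<open>q u u = 1\<close>.\<close>

lemma substitute_shear_relator:
  assumes row: "\<And>w z. w \<in> V \<Longrightarrow> z \<in> V \<Longrightarrow> \<alpha> w \<noteq> 0 \<Longrightarrow> q w z = q u z"
    and V: "u \<in> V" "w \<in> V" "s \<in> V"
  shows "substitute (shear \<gamma> \<alpha> u) (relator w s (q w s) (sheared \<gamma> \<alpha> u p w s))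
    \<in> Idl\<^bsub>free_algebra V\<^esub> (weight_relators V p q)"
proof -
  have a: "scale (\<gamma> w * \<alpha> s * q w s) x = scale (\<gamma> w * \<alpha> s * q w u) x" for x :: "('v, 'k) ncpoly"
    using row[of s] q_column_eq[of s u w] V by (cases "\<alpha> s = 0") auto
  have b: "scale (\<alpha> w * \<gamma> s * q w s) x = scale (\<alpha> w * \<gamma> s * q u s) x" for x :: "('v, 'k) ncpoly"
    using row[of w s] V by (cases "\<alpha> w = 0") auto
  have c: "scale (\<alpha> w * \<alpha> s * q w s) x = scale (\<alpha> w * \<alpha> s) x" for x :: "('v, 'k) ncpoly"
    using row[of w s] row[of s] q_column_eq[of s u u] q_diag[of u] V
    by (cases "\<alpha> w = 0"; cases "\<alpha> s = 0") auto
  have "substitute (shear \<gamma> \<alpha> u) (relator w s (q w s) (sheared \<gamma> \<alpha> u p w s)) =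
      scale (\<gamma> w * \<gamma> s) (relator w s (q w s) (p w s)) +
      scale (\<gamma> w * \<alpha> s) (relator w u (q w u) (p w u)) +
      scale (\<alpha> w * \<gamma> s) (relator u s (q u s) (p u s))"
    using a[of "gen u * gen w"] b[of "gen s * gen u"] c[of "gen u * gen u"]
    by (simp add: relator_def shear_def sheared_def substitute_add substitute_diff
        substitute_mult substitute_scale scale_simps scale_add_left distrib_left distrib_right mult_ac)
  also have "\<dots> \<in> Idl\<^bsub>free_algebra V\<^esub> (weight_relators V p q)"
    using V
    by (intro ideal_free_algebraD(2,4)[OF genideal_free_algebra[OF weight_relators_closed]]
        relator_in_genideal)
  finally show ?thesis .
qed

text \<open>A nonzero value of the sheared form comes from a nonzero value of \<open>p\<close> at
  \<open>w\<close> and \<open>s\<close>, possibly with one of them replaced by \<open>u\<close>. The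
  replaced letter then has the same row of \<open>q\<close> as \<open>u\<close>, so the conditions
  on \<open>q\<close> carry over.\<close>

lemma qW_weights_sheared:
  assumes row: "\<And>w z. w \<in> V \<Longrightarrow> z \<in> V \<Longrightarrow> \<alpha> w \<noteq> 0 \<Longrightarrow> q w z = q u z"
    and u: "u \<in> V"
  shows "qW_weights V (sheared \<gamma> \<alpha> u p) q"
proof
  fix w s assume V: "w \<in> V" "s \<in> V"
  show "sheared \<gamma> \<alpha> u p w s = - sheared \<gamma> \<alpha> u p s w"
    using p_skew[OF V] p_skew[OF V(1) u] p_skew[OF V(2) u] by (simp add: sheared_def algebra_simps)
  assume "sheared \<gamma> \<alpha> u p w s \<noteq> 0"
  then consider "p w s \<noteq> 0" | "\<alpha> s \<noteq> 0" "p w u \<noteq> 0" | "\<alpha> w \<noteq> 0" "p u s \<noteq> 0"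
    unfolding sheared_def by fastforce
  then have "q w s = 1 \<and> (\<forall>z\<in>V. q w z * q s z = 1)"
  proof cases
    case 1
    then show ?thesis using p_imp_q p_imp_q_mult V by auto
  next
    case 2
    then show ?thesis
      using p_imp_q[of w u] p_imp_q_mult[of w u] row[of s] q_column_eq[of s u w] V u by auto
  next
    case 3
    then show ?thesis
      using p_imp_q[of u s] p_imp_q_mult[of u s] row[of w] V u by auto
  qed
  then show "q w s = 1" and "z \<in> V \<Longrightarrow> q w z * q s z = 1" for z
    by auto
next
  fix w assume "w \<in> V"
  then show "sheared \<gamma> \<alpha> u p w w = 0"
    using p_skew[of w u] u p_diag[of w] by (simp add: sheared_def)
qed (use q_mult_swap q_diag in auto)

text \<open>The shear is invertible because \<open>u\<close> itself is only rescaled and all factors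
  \<open>\<gamma>\<close> are nonzero; the inverse is again a shear with pivot
  \<open>u\<close>.\<close>

lemma weight_algebra_sheared:
  assumes row: "\<And>w z. w \<in> V \<Longrightarrow> z \<in> V \<Longrightarrow> \<alpha> w \<noteq> 0 \<Longrightarrow> q w z = q u z"
    and u: "u \<in> V" and \<alpha>: "\<alpha> u = 0" and \<gamma>: "\<And>w. \<gamma> w \<noteq> 0"
  shows "algebra_isomorphic (weight_algebra V p q) (weight_algebra V (sheared \<gamma> \<alpha> u p) q)"
proof -
  \<comment> \<open>Coefficients obtained by solving
    \<open>w' = \<gamma> w * w + \<alpha> w * u\<close> and \<open>u' = \<gamma> u * u\<close> for
    \<open>w\<close>.\<close>
  define \<gamma>' where "\<gamma>' = (\<lambda>w. inverse (\<gamma> w))"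
  define \<alpha>' where "\<alpha>' = (\<lambda>w. - \<alpha> w / (\<gamma> w * \<gamma> u))"
  interpret sheared: qW_weights V "sheared \<gamma> \<alpha> u p" q
    by (rule qW_weights_sheared[OF row u])
  have row': "q w z = q u z" if "w \<in> V" "z \<in> V" "\<alpha>' w \<noteq> 0" for w z
    using row[OF that(1,2)] that(3) by (simp add: \<alpha>'_def)
  \<comment> \<open>Shearing back restores \<open>p\<close>, so
    \<open>substitute_shear_relator\<close>, taken for the sheared weights, also covers the inverse
    substitution.\<close>
  have inverse: "sheared \<gamma>' \<alpha>' u (sheared \<gamma> \<alpha> u p) w s = p w s" if "w \<in> V" "s \<in> V" for w s
    using \<gamma> \<alpha> p_diag[OF u]
    by (simp add: sheared_def \<gamma>'_def \<alpha>'_def field_simps)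
  show ?thesis
    unfolding weight_algebra_def
  proof (rule algebra_isomorphic_presented[where f = "shear \<gamma>' \<alpha>' u" and g = "shear \<gamma> \<alpha> u"])
    show "substitute (shear \<gamma>' \<alpha>' u) r
        \<in> Idl\<^bsub>free_algebra V\<^esub> (weight_relators V (sheared \<gamma> \<alpha> u p) q)"
      if r: "r \<in> weight_relators V p q" for r
    proof -
      obtain w s where "w \<in> V" "s \<in> V" "r = relator w s (q w s) (p w s)"
        using r by (auto simp: weight_relators_def)
      then show ?thesis
        using sheared.substitute_shear_relator
          [OF row' u, where w = w and s = s and \<gamma> = \<gamma>' and \<alpha> = \<alpha>']
        by (simp add: inverse)
    qed
    show "substitute (shear \<gamma> \<alpha> u) r \<in> Idl\<^bsub>free_algebra V\<^esub> (weight_relators V p q)"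
      if "r \<in> weight_relators V (sheared \<gamma> \<alpha> u p) q" for r
      using that substitute_shear_relator[OF row u]
      unfolding weight_relators_def[of V "sheared \<gamma> \<alpha> u p"] by blast
    show "substitute (shear \<gamma> \<alpha> u) (shear \<gamma>' \<alpha>' u w) = gen w"
      and "substitute (shear \<gamma>' \<alpha>' u) (shear \<gamma> \<alpha> u w) = gen w" for w
      using \<gamma> \<alpha>
      by (simp_all add: shear_def \<gamma>'_def \<alpha>'_def substitute_add substitute_diff
          substitute_scale scale_simps
          field_simps flip: scale_add_left)
  qed (simp_all add: weight_relators_closed free_algebra_closed shear_def u)
qed

text \<open>One Gram-Schmidt step: two shears, with pivots \<open>u\<close> and then
  \<open>v\<close>, make \<open>u\<close>, \<open>v\<close> a hyperbolic pair orthogonal to all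
  other letters. The last property protects pairs split off earlier.\<close>

lemma pivot:
  assumes uv: "u \<in> V" "v \<in> V" "p u v \<noteq> 0"
  obtains p' where "qW_weights V p' q"
    "algebra_isomorphic (weight_algebra V p q) (weight_algebra V p' q)"
    "p' u v = 1" "\<And>w. w \<in> V \<Longrightarrow> w \<noteq> v \<Longrightarrow> p' u w = 0" "\<And>w. w \<in> V \<Longrightarrow> w \<noteq> u \<Longrightarrow> p' v w = 0"
    "\<And>w z. w \<in> V \<Longrightarrow> z \<in> V \<Longrightarrow> w \<noteq> u \<Longrightarrow> w \<noteq> v \<Longrightarrow> p w u = 0 \<Longrightarrow> p w v = 0 \<Longrightarrow> p' w z = p w z"
proof -
  \<comment> \<open>Rescaling \<open>u\<close> makes its pairing with \<open>v\<close> equal to 1;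
    the multiple of \<open>u\<close> added to any other \<open>w\<close> cancels
    \<open>p w v\<close>.\<close>
  define \<gamma> where "\<gamma> = (\<lambda>w. if w = u then inverse (p u v) else 1)"
  define \<alpha> where "\<alpha> = (\<lambda>w. if w = u then 0 else - p w v / p u v)"
  define p1 where "p1 = sheared \<gamma> \<alpha> u p"
  \<comment> \<open>Now \<open>p1 v u = -1\<close>, so adding \<open>p1 w u\<close> times
    \<open>v\<close> cancels the pairing of \<open>w\<close> with \<open>u\<close>, while pairings
    with \<open>v\<close> are unaffected.\<close>
  define \<beta> where "\<beta> = (\<lambda>w. if w = v then 0 else p1 w u)"
  define p2 where "p2 = sheared (\<lambda>_. 1) \<beta> v p1"
  have neq: "u \<noteq> v" using uv p_diag by auto
  \<comment> \<open>A nonzero \<open>\<alpha> w\<close> means that \<open>w\<close>, like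
    \<open>u\<close>, pairs nontrivially with \<open>v\<close>.\<close>
  have row1: "q w z = q u z" if "w \<in> V" "z \<in> V" "\<alpha> w \<noteq> 0" for w z
    using p_imp_q_row_eq[of u v w z] that uv by (auto simp: \<alpha>_def split: if_splits)
  interpret p1: qW_weights V p1 q
    unfolding p1_def by (rule qW_weights_sheared[OF row1 uv(1)])
  have p1_uv: "p1 u v = 1"
    using uv neq p_diag[of v] by (simp add: p1_def sheared_def \<gamma>_def \<alpha>_def)
  have p1_v: "p1 w v = 0" if "w \<in> V" "w \<noteq> u" for w
    using that uv neq p_diag[of v] by (simp add: p1_def sheared_def \<gamma>_def \<alpha>_def)
  have row2: "q w z = q v z" if "w \<in> V" "z \<in> V" "\<beta> w \<noteq> 0" for w z
    using p1.p_imp_q_row_eq[of v u w z] p1.p_skew[of v u] p1_uv that uv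
    by (auto simp: \<beta>_def split: if_splits)
  show thesis
  proof
    show "qW_weights V p2 q"
      unfolding p2_def by (rule p1.qW_weights_sheared[OF row2 uv(2)])
    have "algebra_isomorphic (weight_algebra V p q) (weight_algebra V p1 q)"
      unfolding p1_def by (rule weight_algebra_sheared[OF row1 uv(1)]) (auto simp: \<alpha>_def \<gamma>_def uv)
    moreover have "algebra_isomorphic (weight_algebra V p1 q) (weight_algebra V p2 q)"
      unfolding p2_def by (rule p1.weight_algebra_sheared[OF row2 uv(2)]) (auto simp: \<beta>_def)
    ultimately show "algebra_isomorphic (weight_algebra V p q) (weight_algebra V p2 q)"
      by (rule algebra_isomorphic_trans)
    show "p2 u v = 1"
      using p1_uv uv neq p1.p_diag by (simp add: p2_def sheared_def \<beta>_def)
    show "p2 u w = 0" if "w \<in> V" "w \<noteq> v" for w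
      using p1_uv uv that neq p1.p_diag p1.p_skew[of u w] by (simp add: p2_def sheared_def \<beta>_def)
    show "p2 v w = 0" if "w \<in> V" "w \<noteq> u" for w
      using p1_v[OF that] uv that p1.p_diag p1.p_skew[of v w]
      by (simp add: p2_def sheared_def \<beta>_def)
    show "p2 w z = p w z"
      if "w \<in> V" "z \<in> V" "w \<noteq> u" "w \<noteq> v" "p w u = 0" "p w v = 0" for w z
    proof -
      have "p1 w z = p w z" for z
        using that by (auto simp: p1_def sheared_def \<gamma>_def \<alpha>_def)
      then show ?thesis
        using that by (simp add: p2_def sheared_def \<beta>_def)
    qed
  qed
qed

end

section \<open>Symplectic Gram-Schmidt process and comparison with \<open>S_algebra\<close>\<close>

section \<open>Normal form of the weights\<close>

definition S_letters :: "nat \<Rightarrow> nat \<Rightarrow> S_letter set" where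
  "S_letters n r = LetterY ` {1..n} \<union> LetterX ` {1..r}"

text \<open>
  The vertices \<open>\<psi> (LetterX i)\<close> and \<open>\<psi> (LetterY i)\<close>, \<open>i \<le> r\<close>, are \<open>r\<close> hyperbolic pairs split off
  orthogonally from the rest.
\<close>

definition hyperbolic :: "'v set \<Rightarrow> ('v \<Rightarrow> 'v \<Rightarrow> 'k::field) \<Rightarrow> nat \<Rightarrow> (S_letter \<Rightarrow> 'v) \<Rightarrow> bool" where
  "hyperbolic V p r \<psi> \<longleftrightarrow>
    inj_on \<psi> (S_letters r r) \<and> \<psi> ` S_letters r r \<subseteq> V \<and>
    (\<forall>i\<in>{1..r}. p (\<psi> (LetterX i)) (\<psi> (LetterY i)) = 1 \<and>
      (\<forall>z\<in>V. z \<noteq> \<psi> (LetterY i) \<longrightarrow> p (\<psi> (LetterX i)) z = 0) \<and>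
      (\<forall>z\<in>V. z \<noteq> \<psi> (LetterX i) \<longrightarrow> p (\<psi> (LetterY i)) z = 0))"

lemma S_letters_Suc:
  "S_letters (Suc r) (Suc r) = insert (LetterX (Suc r)) (insert (LetterY (Suc r)) (S_letters r r))"
  by (auto simp: S_letters_def atLeastAtMostSuc_conv)

lemma hyperbolic_orthogonal:
  assumes "hyperbolic V p r \<psi>" "w \<in> \<psi> ` S_letters r r" "z \<in> V" "z \<notin> \<psi> ` S_letters r r"
  shows "p w z = 0"
  using assms unfolding hyperbolic_def S_letters_def by blast

text \<open>Pivots at \<open>u\<close> and \<open>v\<close>. Lying outside the earlier pairs, they
  are orthogonal to these, so the rows of the earlier pairs do not change.\<close>

lemma (in qW_weights) hyperbolic_extend:
  assumes h: "hyperbolic V p r \<psi>"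
    and uv: "u \<in> V - \<psi> ` S_letters r r" "v \<in> V - \<psi> ` S_letters r r" "p u v \<noteq> 0"
  obtains p' \<psi>' where "qW_weights V p' q"
    "algebra_isomorphic (weight_algebra V p q) (weight_algebra V p' q)"
    "hyperbolic V p' (Suc r) \<psi>'"
    "\<psi>' ` S_letters (Suc r) (Suc r) = insert u (insert v (\<psi> ` S_letters r r))"
proof -
  have V: "u \<in> V" "v \<in> V" and neq: "u \<noteq> v"
    using uv p_diag by auto
  obtain p' where p': "qW_weights V p' q"
      "algebra_isomorphic (weight_algebra V p q) (weight_algebra V p' q)"
      "p' u v = 1" "\<And>w. w \<in> V \<Longrightarrow> w \<noteq> v \<Longrightarrow> p' u w = 0" "\<And>w. w \<in> V \<Longrightarrow> w \<noteq> u \<Longrightarrow> p' v w = 0"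
      "\<And>w z. w \<in> V \<Longrightarrow> z \<in> V \<Longrightarrow> w \<noteq> u \<Longrightarrow> w \<noteq> v \<Longrightarrow> p w u = 0 \<Longrightarrow> p w v = 0 \<Longrightarrow> p' w z = p w z"
    using pivot[OF V uv(3)] by blast
  define \<psi>' where "\<psi>' = \<psi>(LetterX (Suc r) := u, LetterY (Suc r) := v)"
  have new: "LetterX (Suc r) \<notin> S_letters r r" "LetterY (Suc r) \<notin> S_letters r r"
    by (auto simp: S_letters_def)
  have old: "\<psi>' l = \<psi> l" if "l \<in> S_letters r r" for l
    using that new by (auto simp: \<psi>'_def)
  have image_old: "\<psi>' ` S_letters r r = \<psi> ` S_letters r r"
    using old by auto
  have unchanged: "p' (\<psi> l) z = p (\<psi> l) z" if "l \<in> S_letters r r" "z \<in> V" for l z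
  proof -
    have "\<psi> l \<in> V" "\<psi> l \<noteq> u" "\<psi> l \<noteq> v" "p (\<psi> l) u = 0" "p (\<psi> l) v = 0"
      using that(1) h uv hyperbolic_orthogonal[OF h, of "\<psi> l"] by (auto simp: hyperbolic_def)
    then show ?thesis using p'(6) that(2) by blast
  qed
  show thesis
  proof
    show "\<psi>' ` S_letters (Suc r) (Suc r) = insert u (insert v (\<psi> ` S_letters r r))"
      unfolding S_letters_Suc image_insert image_old by (simp add: \<psi>'_def)
    have "inj_on \<psi>' (S_letters r r)"
      using h old by (auto simp: hyperbolic_def inj_on_def)
    then have "inj_on \<psi>' (S_letters (Suc r) (Suc r))"
      unfolding S_letters_Suc using uv neq image_old new by (auto simp: \<psi>'_def)
    moreover have "\<psi>' ` S_letters (Suc r) (Suc r) \<subseteq> V"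
      unfolding S_letters_Suc image_insert image_old using V h
      by (auto simp: \<psi>'_def hyperbolic_def)
    moreover have "p' (\<psi>' (LetterX i)) (\<psi>' (LetterY i)) = 1 \<and>
        (\<forall>z\<in>V. z \<noteq> \<psi>' (LetterY i) \<longrightarrow> p' (\<psi>' (LetterX i)) z = 0) \<and>
        (\<forall>z\<in>V. z \<noteq> \<psi>' (LetterX i) \<longrightarrow> p' (\<psi>' (LetterY i)) z = 0)" if i: "i \<in> {1..Suc r}" for i
    proof (cases "i = Suc r")
      case True
      then show ?thesis using p'(3-5) by (simp add: \<psi>'_def)
    next
      case False
      then have i': "i \<in> {1..r}" using i by auto
      then have l: "LetterX i \<in> S_letters r r" "LetterY i \<in> S_letters r r"
        by (auto simp: S_letters_def)
      then show ?thesis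
        using h i' unchanged[OF l(1)] unchanged[OF l(2)]
        by (auto simp: old hyperbolic_def)
    qed
    ultimately show "hyperbolic V p' (Suc r) \<psi>'"
      by (simp add: hyperbolic_def)
  qed (fact p')+
qed

lemma algebra_isomorphic_refl: "algebra_isomorphic A A"
  unfolding algebra_isomorphic_def by (intro bexI[of _ id] ring_iso_set_refl) auto

text \<open>Induction on the number of letters outside the pairs: each extension uses up two of
  them, and the process stops once \<open>p\<close> vanishes on the remainder.\<close>

lemma hyperbolic_normal_form:
  assumes "finite V" "qW_weights V p q" "hyperbolic V p r \<psi>"
  obtains p' r' \<psi>' where "qW_weights V p' q"
    "algebra_isomorphic (weight_algebra V p q) (weight_algebra V p' q)"
    "hyperbolic V p' r' \<psi>'"
    "\<And>u v. u \<in> V - \<psi>' ` S_letters r' r' \<Longrightarrow> v \<in> V - \<psi>' ` S_letters r' r' \<Longrightarrow> p' u v = 0"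
  using assms(2,3)
proof (induction "card (V - \<psi> ` S_letters r r)" arbitrary: p r \<psi> thesis rule: less_induct)
  case less
  interpret qW_weights V p q by fact
  show ?case
  proof (cases "\<forall>u\<in>V - \<psi> ` S_letters r r. \<forall>v\<in>V - \<psi> ` S_letters r r. p u v = 0")
    case True
    then show ?thesis
      using less.prems algebra_isomorphic_refl by blast
  next
    case False
    then obtain u v where uv: "u \<in> V - \<psi> ` S_letters r r" "v \<in> V - \<psi> ` S_letters r r" "p u v \<noteq> 0"
      by blast
    obtain p1 \<psi>1 where 1: "qW_weights V p1 q"
      "algebra_isomorphic (weight_algebra V p q) (weight_algebra V p1 q)"
      "hyperbolic V p1 (Suc r) \<psi>1"
      "\<psi>1 ` S_letters (Suc r) (Suc r) = insert u (insert v (\<psi> ` S_letters r r))"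
      using hyperbolic_extend[OF less.prems(3) uv] .
    have "V - \<psi>1 ` S_letters (Suc r) (Suc r) \<subset> V - \<psi> ` S_letters r r"
      using uv unfolding 1(4) by blast
    then have smaller: "card (V - \<psi>1 ` S_letters (Suc r) (Suc r)) < card (V - \<psi> ` S_letters r r)"
      using assms(1) by (intro psubset_card_mono) auto
    show ?thesis
      by (rule less.hyps[OF smaller _ 1(1,3)])
        (use less.prems(1) algebra_isomorphic_trans[OF 1(2)] in blast)
  qed
qed

lemma S_relations_relator:
  "S_relations n r \<Lambda> =
     {relator (LetterY i) (LetterY j) (\<Lambda> i j) 0 | i j. i \<in> {1..n} \<and> j \<in> {1..n}} \<union>
     {relator (LetterX i) (LetterY i) 1 1 | i. i \<in> {1..r}} \<union>
     {relator (LetterX i) (LetterY j) (inverse (\<Lambda> i j)) 0 | i j.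
        i \<in> {1..r} \<and> j \<in> {1..n} \<and> i \<noteq> j} \<union>
     {relator (LetterX i) (LetterX j) (\<Lambda> i j) 0 | i j. i \<in> {1..r} \<and> j \<in> {1..r}}"
  by (simp add: S_relations_def relator_def diff_diff_eq)

text \<open>The matrix records \<open>q\<close> on the letters \<open>LetterY\<close> only. As
  \<open>LetterX i\<close> pairs to 1 with \<open>LetterY i\<close>, their rows of \<open>q\<close>
  are inverse, which forces the remaining coefficients in the relations of
  \<open>S_algebra\<close>.\<close>

lemma S_algebra_eq_weight_algebra:
  assumes "qW_weights (S_letters n r) p q" and "r \<le> n"
    and xy: "\<And>i. i \<in> {1..r} \<Longrightarrow> p (LetterX i) (LetterY i) = 1"
    and yy: "\<And>i j. i \<in> {1..n} \<Longrightarrow> j \<in> {1..n} \<Longrightarrow> p (LetterY i) (LetterY j) = 0"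
    and xy': "\<And>i j. i \<in> {1..r} \<Longrightarrow> j \<in> {1..n} \<Longrightarrow> i \<noteq> j \<Longrightarrow> p (LetterX i) (LetterY j) = 0"
    and xx: "\<And>i j. i \<in> {1..r} \<Longrightarrow> j \<in> {1..r} \<Longrightarrow> p (LetterX i) (LetterX j) = 0"
  defines "\<Lambda> \<equiv> \<lambda>i j. q (LetterY i) (LetterY j)"
  shows "S_algebra n r \<Lambda> = weight_algebra (S_letters n r) p q" and "mult_antisymmetric n \<Lambda>"
proof -
  interpret qW_weights "S_letters n r" p q by fact
  have Y: "LetterY i \<in> S_letters n r" if "i \<in> {1..n}" for i
    using that by (simp add: S_letters_def)
  have X: "LetterX i \<in> S_letters n r" if "i \<in> {1..r}" for i
    using that by (simp add: S_letters_def)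
  have n: "i \<in> {1..n}" if "i \<in> {1..r}" for i
    using that \<open>r \<le> n\<close> by simp
  have qx: "q (LetterX i) l = inverse (q (LetterY i) l)" if "i \<in> {1..r}" "l \<in> S_letters n r" for i l
    using p_imp_q_mult[of "LetterX i" "LetterY i" l] xy X Y n that q_nonzero[of "LetterY i" l]
    by (simp add: field_simps)
  have q_xy: "q (LetterX i) (LetterY j) = inverse (\<Lambda> i j)" if "i \<in> {1..r}" "j \<in> {1..n}" for i j
    using qx that Y by (simp add: \<Lambda>_def)
  \<comment> \<open>Inverting twice, for the row of \<open>LetterX i\<close> and for that of
    \<open>LetterX j\<close>, gives back \<open>\<Lambda> i j\<close>.\<close>
  have q_xx: "q (LetterX i) (LetterX j) = \<Lambda> i j" if "i \<in> {1..r}" "j \<in> {1..r}" for i j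
  proof -
    have "q (LetterX i) (LetterX j) = inverse (q (LetterY i) (LetterX j))"
      using qx that X by simp
    also have "\<dots> = q (LetterX j) (LetterY i)"
      using q_eq_inverse[of "LetterX j" "LetterY i"] that X Y n by simp
    also have "\<dots> = inverse (q (LetterY j) (LetterY i))"
      using qx that Y n by simp
    also have "\<dots> = \<Lambda> i j"
      using q_eq_inverse[of "LetterY i" "LetterY j"] that Y n by (simp add: \<Lambda>_def)
    finally show ?thesis .
  qed
  have q_xy_diag: "q (LetterX i) (LetterY i) = 1" if "i \<in> {1..r}" for i
    using p_imp_q[of "LetterX i" "LetterY i"] xy that X Y n by simp
  let ?rel = "\<lambda>u v. relator u v (q u v) (p u v)"
  have YY: "relator (LetterY i) (LetterY j) (\<Lambda> i j) 0 = ?rel (LetterY i) (LetterY j)"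
    if "i \<in> {1..n}" "j \<in> {1..n}" for i j
    using that by (simp add: yy \<Lambda>_def)
  have XY: "relator (LetterX i) (LetterY i) 1 1 = ?rel (LetterX i) (LetterY i)"
    if "i \<in> {1..r}" for i
    using that by (simp only: xy q_xy_diag)
  have XY': "relator (LetterX i) (LetterY j) (inverse (\<Lambda> i j)) 0 = ?rel (LetterX i) (LetterY j)"
    if "i \<in> {1..r}" "j \<in> {1..n}" "i \<noteq> j" for i j
    using xy'[OF that] q_xy[OF that(1,2)] by simp
  have XX: "relator (LetterX i) (LetterX j) (\<Lambda> i j) 0 = ?rel (LetterX i) (LetterX j)"
    if "i \<in> {1..r}" "j \<in> {1..r}" for i j
    using that by (simp only: xx q_xx)
  have "S_relations n r \<Lambda> \<subseteq> weight_relators (S_letters n r) p q"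
    unfolding S_relations_relator weight_relators_def using X Y n YY XY XY' XX by blast
  \<comment> \<open>A mixed pair has its relation only with \<open>LetterX\<close> in front, hence
    the disjunction over both orders.\<close>
  moreover have "?rel u v \<in> S_relations n r \<Lambda> \<or> ?rel v u \<in> S_relations n r \<Lambda>"
    if uv: "u \<in> S_letters n r" "v \<in> S_letters n r" for u v
  proof -
    have 1: "?rel (LetterY i) (LetterY j) \<in> S_relations n r \<Lambda>" if "i \<in> {1..n}" "j \<in> {1..n}" for i j
      unfolding YY[OF that, symmetric] S_relations_relator using that by blast
    have 2: "?rel (LetterX i) (LetterX j) \<in> S_relations n r \<Lambda>" if "i \<in> {1..r}" "j \<in> {1..r}" for i j
      unfolding XX[OF that, symmetric] S_relations_relator using that by blast
    have 3: "?rel (LetterX i) (LetterY j) \<in> S_relations n r \<Lambda>" if "i \<in> {1..r}" "j \<in> {1..n}" for i j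
    proof (cases "i = j")
      case True
      then show ?thesis
        unfolding True[symmetric] XY[OF that(1), symmetric] S_relations_relator using that by blast
    next
      case False
      then show ?thesis
        unfolding XY'[OF that False, symmetric] S_relations_relator using that by blast
    qed
    show ?thesis
      using uv 1 2 3 unfolding S_letters_def by blast
  qed
  ultimately have "presented_algebra (S_letters n r) (S_relations n r \<Lambda>) =
      weight_algebra (S_letters n r) p q"
    by (intro presented_algebra_eq_weight_algebra) auto
  then show "S_algebra n r \<Lambda> = weight_algebra (S_letters n r) p q"
    by (simp add: S_algebra_def S_letters_def)
  show "mult_antisymmetric n \<Lambda>"
    using q_nonzero q_mult_swap q_diag Y by (simp add: mult_antisymmetric_def \<Lambda>_def)
qed

text \<open>Runs the process from the empty family of pairs. Each resulting pair supplies one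
  \<open>LetterX\<close> and one \<open>LetterY\<close>, each remaining letter a further
  \<open>LetterY\<close>.\<close>

lemma weight_algebra_isomorphic_S_algebra:
  assumes "finite V" "qW_weights V p q"
  obtains n r \<Lambda> where "r \<le> n" "card V = n + r" "mult_antisymmetric n \<Lambda>"
    "algebra_isomorphic (weight_algebra V p q) (S_algebra n r \<Lambda>)"
proof -
  have "hyperbolic V p 0 \<psi>" for \<psi>
    by (simp add: hyperbolic_def S_letters_def)
  then obtain p' r \<psi> where p': "qW_weights V p' q"
    "algebra_isomorphic (weight_algebra V p q) (weight_algebra V p' q)"
    and h: "hyperbolic V p' r \<psi>"
    and rest: "\<And>u v. u \<in> V - \<psi> ` S_letters r r \<Longrightarrow> v \<in> V - \<psi> ` S_letters r r \<Longrightarrow> p' u v = 0"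
    using hyperbolic_normal_form[OF assms] by metis
  interpret qW_weights V p' q by fact
  define W where "W = V - \<psi> ` S_letters r r"
  define n where "n = r + card W"
  have "finite W" using assms(1) by (simp add: W_def)
  then obtain e where e: "bij_betw e {1..card W} W"
    using ex_bij_betw_nat_finite_1 by blast
  \<comment> \<open>The enumeration \<open>e\<close> of the remaining letters starts at 1, so
    indices above \<open>r\<close> are shifted down by \<open>r\<close>.\<close>
  define \<chi> where "\<chi> = (\<lambda>l. case l of LetterX i \<Rightarrow> \<psi> l | LetterY i \<Rightarrow> if i \<le> r then \<psi> l else e (i - r))"
  have \<chi>_old: "\<chi> l = \<psi> l" if "l \<in> S_letters r r" for l
    using that by (auto simp: \<chi>_def S_letters_def)
  have shift: "bij_betw (\<lambda>i. i - r) {Suc r..n} {1..card W}"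
    by (rule bij_betwI[where g = "\<lambda>i. i + r"]) (auto simp: n_def)
  have "bij_betw (\<lambda>i. \<chi> (LetterY i)) {Suc r..n} W"
    using bij_betw_trans[OF shift e] by (rule bij_betw_cong[THEN iffD1, rotated]) (auto simp: \<chi>_def)
  then have new: "bij_betw \<chi> (LetterY ` {Suc r..n}) W"
    by (auto simp: bij_betw_def inj_on_def image_image)
  have "bij_betw \<chi> (S_letters r r) (\<psi> ` S_letters r r)"
    using h \<chi>_old by (auto simp: bij_betw_def hyperbolic_def inj_on_def)
  then have "bij_betw \<chi> (S_letters r r \<union> LetterY ` {Suc r..n}) (\<psi> ` S_letters r r \<union> W)"
    using new by (rule bij_betw_combine) (auto simp: W_def)
  moreover have "S_letters r r \<union> LetterY ` {Suc r..n} = S_letters n r"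
    by (force simp: S_letters_def n_def)
  moreover have "\<psi> ` S_letters r r \<union> W = V"
    using h by (auto simp: W_def hyperbolic_def)
  ultimately have bij: "bij_betw \<chi> (S_letters n r) V" by simp
  then have inj: "\<chi> l = \<chi> m \<longleftrightarrow> l = m" if "l \<in> S_letters n r" "m \<in> S_letters n r" for l m
    using that by (auto simp: bij_betw_def inj_on_def)
  have V: "\<chi> l \<in> V" if "l \<in> S_letters n r" for l
    using bij that by (auto simp: bij_betw_def)
  have X: "LetterX i \<in> S_letters n r" "\<chi> (LetterX i) = \<psi> (LetterX i)" if "i \<in> {1..r}" for i
    using that by (auto simp: S_letters_def \<chi>_def)
  have Y: "LetterY i \<in> S_letters n r" if "i \<in> {1..n}" for i
    using that by (auto simp: S_letters_def)
  have Y': "\<chi> (LetterY i) = \<psi> (LetterY i)" if "i \<in> {1..r}" for i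
    using that by (auto simp: \<chi>_def)
  have Yr: "LetterY i \<in> S_letters n r" if "i \<in> {1..r}" for i
    using Y[of i] that by (simp add: n_def)
  have hx: "p' (\<chi> (LetterX i)) (\<chi> l) = (if l = LetterY i then 1 else 0)"
    if "i \<in> {1..r}" "l \<in> S_letters n r" for i l
    using that h V[OF that(2)] inj[of l "LetterY i"] Y[of i]
    by (auto simp: X Y' hyperbolic_def n_def)
  have hy: "p' (\<chi> (LetterY i)) (\<chi> (LetterY j)) = 0" if "i \<in> {1..r}" "j \<in> {1..n}" for i j
    using that h V[OF Y[OF that(2)]] inj[of "LetterY j" "LetterX i"] Y[of j] X[of i]
    by (auto simp: Y' hyperbolic_def n_def)
  have hy': "p' (\<chi> (LetterY i)) (\<chi> (LetterY j)) = 0" if ij: "i \<in> {1..n}" "j \<in> {1..n}" for i j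
  proof -
    \<comment> \<open>If an index belongs to a pair, \<open>hy\<close> applies, after skew-symmetry
      when it is the second one; otherwise both letters lie in \<open>W\<close>, where
      \<open>p'\<close> vanishes.\<close>
    consider "i \<in> {1..r}" | "j \<in> {1..r}" | "i \<in> {Suc r..n}" "j \<in> {Suc r..n}"
      using ij by fastforce
    then show ?thesis
    proof cases
      case 2
      then show ?thesis
        using hy[of j i] p_skew[OF V V, of "LetterY i" "LetterY j"] Y ij by simp
    next
      case 3
      then have "\<chi> (LetterY i) \<in> W" "\<chi> (LetterY j) \<in> W"
        using new by (auto simp: bij_betw_def)
      then show ?thesis
        using rest by (simp add: W_def)
    qed (use hy ij in blast)
  qed
  define p2 where "p2 = (\<lambda>l m. p' (\<chi> l) (\<chi> m))"
  define q2 where "q2 = (\<lambda>l m. q (\<chi> l) (\<chi> m))"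
  have weights2: "qW_weights (S_letters n r) p2 q2"
    unfolding p2_def q2_def by (rule qW_weights_reindex[OF p'(1) V])
  have "r \<le> n" by (simp add: n_def)
  note S = S_algebra_eq_weight_algebra[OF weights2 this]
  show thesis
  proof
    show "r \<le> n" by fact
    have "card (S_letters n r) = card (LetterY ` {1..n}) + card (LetterX ` {1..r})"
      unfolding S_letters_def by (intro card_Un_disjoint) auto
    then show "card V = n + r"
      using bij_betw_same_card[OF bij] by (simp add: card_image inj_on_def)
    show "mult_antisymmetric n (\<lambda>i j. q2 (LetterY i) (LetterY j))"
      by (rule S(2)) (simp_all add: p2_def hx hy' X(1) Y Yr)
    have "S_algebra n r (\<lambda>i j. q2 (LetterY i) (LetterY j)) = weight_algebra (S_letters n r) p2 q2"
      by (rule S(1)) (simp_all add: p2_def hx hy' X(1) Y Yr)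
    then show "algebra_isomorphic (weight_algebra V p q)
        (S_algebra n r (\<lambda>i j. q2 (LetterY i) (LetterY j)))"
      using algebra_isomorphic_trans[OF p'(2) weight_algebra_reindex[OF bij]]
      by (simp add: p2_def q2_def)
  qed
qed

section \<open>From admissible graphs to weight matrices\<close>

section \<open>Weights of a graph\<close>

text \<open>An edge read backwards counts with the opposite sign and a missing edge as 0, matching
  the moves that define equivalence.\<close>

definition weyl_weight :: "('v, 'k::field) qW_graph \<Rightarrow> 'v \<Rightarrow> 'v \<Rightarrow> 'k" where
  "weyl_weight \<Gamma> u v =
    (case edges \<Gamma> (u, v) of
      Some (Weyl m) \<Rightarrow> of_int m
    | Some (Quantum _) \<Rightarrow> 0
    | None \<Rightarrow> (case edges \<Gamma> (v, u) of Some (Weyl m) \<Rightarrow> - of_int m | _ \<Rightarrow> 0))"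

text \<open>The multiplicative counterpart, with inversion for negation and default 1.\<close>

definition quantum_weight :: "('v, 'k::field) qW_graph \<Rightarrow> 'v \<Rightarrow> 'v \<Rightarrow> 'k" where
  "quantum_weight \<Gamma> u v =
    (case edges \<Gamma> (u, v) of
      Some (Quantum a) \<Rightarrow> a
    | Some (Weyl _) \<Rightarrow> 1
    | None \<Rightarrow> (case edges \<Gamma> (v, u) of Some (Quantum a) \<Rightarrow> inverse a | _ \<Rightarrow> 1))"

lemma is_qW_graphD:
  assumes "is_qW_graph \<Gamma>"
  shows "edges \<Gamma> (u, u) = None"
    and "edges \<Gamma> (u, v) = Some l \<Longrightarrow> edges \<Gamma> (v, u) = None"
    and "edges \<Gamma> (u, v) \<noteq> Some (Quantum 0)"
    and "edges \<Gamma> (u, v) = Some l \<Longrightarrow> u \<in> vertices \<Gamma> \<and> v \<in> vertices \<Gamma>"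
  using assms unfolding is_qW_graph_def by (metis, metis option.distinct(1), metis, blast)

lemma qW_step_weights:
  assumes "qW_step \<Gamma> \<Gamma>'"
  shows "vertices \<Gamma>' = vertices \<Gamma> \<and> weyl_weight \<Gamma>' = weyl_weight \<Gamma> \<and>
    quantum_weight \<Gamma>' = quantum_weight \<Gamma>"
  using assms
proof cases
  case (add_weyl u v)
  then show ?thesis
    by (auto simp: fun_eq_iff weyl_weight_def quantum_weight_def not_joined_def
        split: option.splits edge_label.splits)
next
  case (add_quantum u v)
  then show ?thesis
    by (auto simp: fun_eq_iff weyl_weight_def quantum_weight_def not_joined_def
        split: option.splits edge_label.splits)
next
  case (reverse_weyl u v m)
  have "u \<noteq> v"
    using is_qW_graphD(1)[OF reverse_weyl(2), of u] reverse_weyl(3) by auto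
  note step = this is_qW_graphD(2)[OF reverse_weyl(2,3)] reverse_weyl
  have "weyl_weight \<Gamma>' x y = weyl_weight \<Gamma> x y \<and> quantum_weight \<Gamma>' x y = quantum_weight \<Gamma> x y" for x y
  proof -
    \<comment> \<open>Reversal changes the edge map only at these two ordered pairs; elsewhere both
      entries that the weights consult stay the same.\<close>
    consider "x = u" "y = v" | "x = v" "y = u" | "(x, y) \<noteq> (u, v)" "(x, y) \<noteq> (v, u)"
      by auto
    then show ?thesis
    proof cases
      case 3
      have "edges \<Gamma>' e = edges \<Gamma> e" if "e \<noteq> (u, v)" "e \<noteq> (v, u)" for e
        using that by (simp add: step(3))
      then have edges: "edges \<Gamma>' (x, y) = edges \<Gamma> (x, y)" "edges \<Gamma>' (y, x) = edges \<Gamma> (y, x)"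
        using 3 by blast+
      show ?thesis
        unfolding weyl_weight_def quantum_weight_def edges by simp
    qed (simp_all add: step weyl_weight_def quantum_weight_def)
  qed
  then show ?thesis
    using step(3) by (simp add: fun_eq_iff)
next
  case (reverse_quantum u v a)
  have "u \<noteq> v"
    using is_qW_graphD(1)[OF reverse_quantum(2), of u] reverse_quantum(3) by auto
  note step = this is_qW_graphD(2)[OF reverse_quantum(2,3)] reverse_quantum
  have "weyl_weight \<Gamma>' x y = weyl_weight \<Gamma> x y \<and> quantum_weight \<Gamma>' x y = quantum_weight \<Gamma> x y" for x y
  proof -
    consider "x = u" "y = v" | "x = v" "y = u" | "(x, y) \<noteq> (u, v)" "(x, y) \<noteq> (v, u)"
      by auto
    then show ?thesis
    proof cases
      case 3
      have "edges \<Gamma>' e = edges \<Gamma> e" if "e \<noteq> (u, v)" "e \<noteq> (v, u)" for e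
        using that by (simp add: step(3))
      then have edges: "edges \<Gamma>' (x, y) = edges \<Gamma> (x, y)" "edges \<Gamma>' (y, x) = edges \<Gamma> (y, x)"
        using 3 by blast+
      show ?thesis
        unfolding weyl_weight_def quantum_weight_def edges by simp
    qed (simp_all add: step weyl_weight_def quantum_weight_def)
  qed
  then show ?thesis
    using step(3) by (simp add: fun_eq_iff)
qed

text \<open>Allows the weights of a triangle to be computed from its standard form.\<close>

lemma qW_equivalent_weights:
  assumes "qW_equivalent \<Gamma> \<Gamma>'"
  shows "vertices \<Gamma>' = vertices \<Gamma> \<and> weyl_weight \<Gamma>' = weyl_weight \<Gamma> \<and>
    quantum_weight \<Gamma>' = quantum_weight \<Gamma>"
  using assms unfolding qW_equivalent_def
proof (induction rule: equivclp_induct)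
  case (step \<Gamma>' \<Gamma>'')
  then show ?case using qW_step_weights[of \<Gamma>' \<Gamma>''] qW_step_weights[of \<Gamma>'' \<Gamma>'] by auto
qed simp

text \<open>A nonzero Weyl weight excludes type (a). Type (b) makes both quantum weights 1. In type
  (c), \<open>u\<close> and \<open>v\<close> must be the ends of the Weyl edge, whose quantum
  weights towards the third vertex are mutually inverse.\<close>

lemma triangle_weights:
  assumes "type_a T \<or> type_b T \<or> type_c T"
    and "vertices T = {u, v, w}" "distinct [u, v, w]" "weyl_weight T u v \<noteq> 0"
  shows "quantum_weight T u w * quantum_weight T v w = 1"
proof -
  have opposite: "edges T (y, x) = None" if "is_qW_graph T" "edges T (x, y) = Some l" for x y l
    using is_qW_graphD(2) that by metis
  consider "type_a T" | "type_b T" | "type_c T" using assms(1) by blast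
  then show ?thesis
  proof cases
    case 1
    then obtain X Y Z where T: "is_qW_graph T" "vertices T = {X, Y, Z}"
      "joined_quantum T X Y" "joined_quantum T Y Z" "joined_quantum T X Z"
      unfolding type_a_def by blast
    have "joined_quantum T x y \<Longrightarrow> joined_quantum T y x" for x y
      by (auto simp: joined_quantum_def)
    then have "joined_quantum T x y" if "x \<in> {X, Y, Z}" "y \<in> {X, Y, Z}" "x \<noteq> y" for x y
      using that T(3-5) by blast
    then have "joined_quantum T u v"
      using assms(2,3) T(2) by (metis distinct_length_2_or_more insertCI)
    with T(1) have "weyl_weight T u v = 0"
      using opposite[of v u] by (auto simp: weyl_weight_def joined_quantum_def)
    then show ?thesis using assms(4) by simp
  next
    case 2
    then obtain X Y Z where T: "is_qW_graph T" "vertices T = {X, Y, Z}"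
      "joined_weyl T X Y" "joined_weyl T Y Z" "joined_weyl T X Z"
      unfolding type_b_def by blast
    have "joined_weyl T x y \<Longrightarrow> joined_weyl T y x" for x y
      by (auto simp: joined_weyl_def)
    then have "joined_weyl T x y" if "x \<in> {X, Y, Z}" "y \<in> {X, Y, Z}" "x \<noteq> y" for x y
      using that T(3-5) by blast
    then have "joined_weyl T u w" "joined_weyl T v w"
      using assms(2,3) T(2) by (metis distinct_length_2_or_more insertCI)+
    with T(1) have "quantum_weight T u w = 1" "quantum_weight T v w = 1"
      using opposite[of w u] opposite[of w v] by (auto simp: quantum_weight_def joined_weyl_def)
    then show ?thesis by simp
  next
    case 3
    then obtain X Y Z m a where T: "is_qW_graph T" "distinct [X, Y, Z]" "vertices T = {X, Y, Z}"
      "edges T (X, Y) = Some (Weyl m)" "edges T (X, Z) = Some (Quantum a)"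
      "edges T (Y, Z) = Some (Quantum (inverse a))"
      unfolding type_c_def by blast
    have "a \<noteq> 0" using T(5) is_qW_graphD(3)[OF T(1)] by auto
    have weyl0: "weyl_weight T X Z = 0" "weyl_weight T Z X = 0" "weyl_weight T Y Z = 0"
      "weyl_weight T Z Y = 0"
      using T opposite[OF T(1) T(5)] opposite[OF T(1) T(6)] by (simp_all add: weyl_weight_def)
    have XY: "quantum_weight T X Z * quantum_weight T Y Z = 1"
      using T(5,6) \<open>a \<noteq> 0\<close> by (simp add: quantum_weight_def)
    \<comment> \<open>Only the position of \<open>Z\<close> matters: as \<open>u\<close> or
      \<open>v\<close> it would make the Weyl weight vanish.\<close>
    have "u \<noteq> v" "u \<in> {X, Y, Z}" "v \<in> {X, Y, Z}" "Z \<in> {u, v, w}"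
      using assms(2,3) T(3) by auto
    then consider "u = Z" "v = X \<or> v = Y" | "v = Z" "u = X \<or> u = Y"
      | "w = Z" "u = X" "v = Y" | "w = Z" "u = Y" "v = X"
      by blast
    then show ?thesis
    proof cases
      case 4
      then show ?thesis using XY by (simp add: mult.commute)
    qed (use weyl0 assms(4) XY in auto)
  qed
qed

lemma weight_subgraph:
  assumes "u \<in> W" "v \<in> W"
  shows "weyl_weight (subgraph \<Gamma> W) u v = weyl_weight \<Gamma> u v"
    and "quantum_weight (subgraph \<Gamma> W) u v = quantum_weight \<Gamma> u v"
proof -
  have edges: "edges (subgraph \<Gamma> W) (u, v) = edges \<Gamma> (u, v)"
    "edges (subgraph \<Gamma> W) (v, u) = edges \<Gamma> (v, u)"
    using assms by (simp_all add: subgraph_def)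
  show "weyl_weight (subgraph \<Gamma> W) u v = weyl_weight \<Gamma> u v"
    and "quantum_weight (subgraph \<Gamma> W) u v = quantum_weight \<Gamma> u v"
    unfolding weyl_weight_def quantum_weight_def edges by (rule refl)+
qed

lemma qW_weights_graph:
  assumes "is_qW_graph \<Gamma>" "qW_admissible \<Gamma>"
  shows "qW_weights (vertices \<Gamma>) (weyl_weight \<Gamma>) (quantum_weight \<Gamma>)"
proof -
  note loop = is_qW_graphD(1)[OF assms(1)] and nonzero = is_qW_graphD(3)[OF assms(1)]
  have single: "edges \<Gamma> (u, v) = None \<or> edges \<Gamma> (v, u) = None" for u v
    using is_qW_graphD(2)[OF assms(1), of u v] by (cases "edges \<Gamma> (u, v)") auto
  have skew: "weyl_weight \<Gamma> u v = - weyl_weight \<Gamma> v u" for u v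
    using single[of u v]
    by (auto simp: weyl_weight_def split: option.splits edge_label.splits)
  have swap: "quantum_weight \<Gamma> u v * quantum_weight \<Gamma> v u = 1" for u v
    using single[of u v] nonzero[of u v] nonzero[of v u]
    by (auto simp: quantum_weight_def split: option.splits edge_label.splits)
  have q1: "quantum_weight \<Gamma> u v = 1" if "weyl_weight \<Gamma> u v \<noteq> 0" for u v
    using that
    by (auto simp: weyl_weight_def quantum_weight_def split: option.splits edge_label.splits)
  have diag: "quantum_weight \<Gamma> u u = 1" "weyl_weight \<Gamma> u u = 0" for u
    using loop by (simp_all add: quantum_weight_def weyl_weight_def)
  have "quantum_weight \<Gamma> u w * quantum_weight \<Gamma> v w = 1"
    if V: "u \<in> vertices \<Gamma>" "v \<in> vertices \<Gamma>" "w \<in> vertices \<Gamma>" and p: "weyl_weight \<Gamma> u v \<noteq> 0" for u v w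
  proof (cases "distinct [u, v, w]")
    \<comment> \<open>Admissibility speaks of three distinct vertices. If \<open>w\<close> is
      \<open>u\<close> or \<open>v\<close>, both factors are 1, since a nonzero Weyl weight comes
      with quantum weight 1.\<close>
    case False
    have "weyl_weight \<Gamma> v u \<noteq> 0" using p skew[of u v] by simp
    then show ?thesis
      using False p diag q1[of u v] q1[of v u] by auto
  next
    case True
    let ?W = "{u, v, w}"
    have "card ?W = 3" "?W \<subseteq> vertices \<Gamma>" using True V by auto
    then obtain T where T: "qW_equivalent (subgraph \<Gamma> ?W) T" "type_a T \<or> type_b T \<or> type_c T"
      using assms(2) unfolding qW_admissible_def by blast
    have "vertices T = ?W" "weyl_weight T = weyl_weight (subgraph \<Gamma> ?W)"
      "quantum_weight T = quantum_weight (subgraph \<Gamma> ?W)"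
      using qW_equivalent_weights[OF T(1)] by (auto simp: subgraph_def)
    then show ?thesis
      using triangle_weights[OF T(2) _ True] p weight_subgraph[of _ ?W _ \<Gamma>] by simp
  qed
  then show ?thesis
    using skew swap q1 diag by unfold_locales
qed

text \<open>Every pair of vertices carries a relation in at least one order, along its edge or as a
  commutator, and each of these is a relator for the two matrices.\<close>

lemma qW_algebra_eq_weight_algebra:
  assumes "is_qW_graph \<Gamma>" "qW_admissible \<Gamma>"
  shows "qW_algebra \<Gamma> = weight_algebra (vertices \<Gamma>) (weyl_weight \<Gamma>) (quantum_weight \<Gamma>)"
proof -
  interpret qW_weights "vertices \<Gamma>" "weyl_weight \<Gamma>" "quantum_weight \<Gamma>"
    by (rule qW_weights_graph[OF assms])
  let ?rel = "\<lambda>u v. relator u v (quantum_weight \<Gamma> u v) (weyl_weight \<Gamma> u v)"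
  have V: "u \<in> vertices \<Gamma>" "v \<in> vertices \<Gamma>" if "edges \<Gamma> (u, v) = Some l" for u v l
    using is_qW_graphD(4)[OF assms(1) that] by auto
  have weyl: "gen u * gen v - gen v * gen u - scale (of_int m) 1 = ?rel u v"
    if "edges \<Gamma> (u, v) = Some (Weyl m)" for u v m
    using that by (simp add: relator_def weyl_weight_def quantum_weight_def)
  have quantum: "gen u * gen v - scale a (gen v * gen u) = ?rel u v"
    if "edges \<Gamma> (u, v) = Some (Quantum a)" for u v a
    using that by (simp add: relator_def weyl_weight_def quantum_weight_def)
  have none: "gen u * gen v - gen v * gen u = ?rel u v" if "not_joined \<Gamma> u v" for u v
    using that by (simp add: relator_def weyl_weight_def quantum_weight_def not_joined_def)
  have "qW_relations \<Gamma> \<subseteq> weight_relators (vertices \<Gamma>) (weyl_weight \<Gamma>) (quantum_weight \<Gamma>)"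
  proof -
    have "?rel u v \<in> weight_relators (vertices \<Gamma>) (weyl_weight \<Gamma>) (quantum_weight \<Gamma>)"
      if "u \<in> vertices \<Gamma>" "v \<in> vertices \<Gamma>" for u v
      using that by (auto simp: weight_relators_def)
    then show ?thesis
      unfolding qW_relations_def using V by (auto simp: weyl quantum none)
  qed
  moreover have "?rel u v \<in> qW_relations \<Gamma> \<or> ?rel v u \<in> qW_relations \<Gamma>"
    if uv: "u \<in> vertices \<Gamma>" "v \<in> vertices \<Gamma>" for u v
  proof -
    have edge: "?rel x y \<in> qW_relations \<Gamma>" if "edges \<Gamma> (x, y) = Some l" for x y l
    proof (cases l)
      case (Weyl m)
      show ?thesis
        using that weyl[of x y m, symmetric] unfolding Weyl qW_relations_def by blast
    next
      case (Quantum a)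
      show ?thesis
        using that quantum[of x y a, symmetric] unfolding Quantum qW_relations_def by blast
    qed
    show ?thesis
    proof (cases "not_joined \<Gamma> u v")
      case True
      then show ?thesis
        using uv none[OF True, symmetric] unfolding qW_relations_def by blast
    next
      case False
      then obtain l where "edges \<Gamma> (u, v) = Some l \<or> edges \<Gamma> (v, u) = Some l"
        by (auto simp: not_joined_def)
      then show ?thesis
        using edge by blast
    qed
  qed
  ultimately show ?thesis
    unfolding qW_algebra_def by (intro presented_algebra_eq_weight_algebra) auto
qed

theorem mainTheorem1:
  fixes \<Gamma> :: "('v, 'k::field_char_0) qW_graph" and N :: nat
  assumes "is_qW_graph \<Gamma>"
    and "qW_admissible \<Gamma>"
    and "card (vertices \<Gamma>) = N"
    and "N \<ge> 1"
  shows "\<exists>(n::nat) (r::nat) (\<Lambda> :: nat \<Rightarrow> nat \<Rightarrow> 'k).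
    n \<ge> 1 \<and> 0 \<le> r \<and> r \<le> n \<and> N = n + r \<and> mult_antisymmetric n \<Lambda> \<and>
    algebra_isomorphic (qW_algebra \<Gamma>) (S_algebra n r \<Lambda>)"
proof -
  have "finite (vertices \<Gamma>)"
    using assms(1) by (simp add: is_qW_graph_def)
  then obtain n r and \<Lambda> :: "nat \<Rightarrow> nat \<Rightarrow> 'k" where "r \<le> n" "card (vertices \<Gamma>) = n + r"
    "mult_antisymmetric n \<Lambda>" "algebra_isomorphic (qW_algebra \<Gamma>) (S_algebra n r \<Lambda>)"
    unfolding qW_algebra_eq_weight_algebra[OF assms(1,2)]
    using weight_algebra_isomorphic_S_algebra qW_weights_graph[OF assms(1,2)] by metis
  \<comment> \<open>If \<open>n\<close> were 0, then \<open>r \<le> n\<close> would give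
    \<open>N = 0\<close>.\<close>
  moreover from this have "n \<ge> 1"
    using assms(3,4) by auto
  ultimately show ?thesis
    using assms(3) by blast
qed

end
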